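(* Let $G$ be a group, $M$ a right $\mathbb Z[G]$-module, $\varphi:G\to Z(G)$ a group homomorphism into the center of $G$, $X=M\times G$ the $G$-Alexander biquandle of $(M,\varphi)$, regarded also as an $X$-set with action $*:=\underline{*}$, and $A$ an abelian group. Let $n\ge1$. For any group $(n+1)$-cocycle $f:C_{n+1}^{\rm gp}(M;\mathbb Z)_G\to A$, the map $$\Phi_f:=f\circ\psi_n\circ\gamma_n:\ C_n^{\rm BR}(X;\mathbb Z)_X\to A$$ is a birack $n$-cocycle of the $G$-Alexander biquandle $X$ with the $X$-set $X$.
   Context: **$G$-Alexander biquandle.** $X=M\times G$ with the operations $(m,g)\,\underline{*}\,(n,h)=(mh+n(\varphi(h)-h),\,h^{-1}gh)$ and $(m,g)\,\overline{*}\,(n,h)=(m\varphi(h),\,g)$. **Birack complex with the $X$-set $X$.** $C_n^{\rm BR}(X;\mathbb Z)_X$ is the free abelian group on $X\times X^n$, with generators $(x_0,x_1,\dots,x_n)$, for $n\ge1$, and $0$ otherwise. For $n\ge2$, $$\partial_n^{\rm BR}(x_0,x_1,\dots,x_n)=\sum_{i=1}^n(-1)^{i-1}\{(x_0,\dots,x_{i-1},x_{i+1},\dots,x_n)-(x_0\underline{*}x_i,x_1\underline{*}x_i,\dots,x_{i-1}\underline{*}x_i,x_{i+1}\overline{*}x_i,\dots,x_n\overline{*}x_i)\},$$ and $\partial_n^{\rm BR}=0$ for $n\le1$. A birack $n$-cocycle (with $X$-set $X$) is a homomorphism $\Phi:C_n^{\rm BR}(X;\mathbb Z)_X\to A$ with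 $\Phi\circ\partial_{n+1}^{\rm BR}=0$. **Group complex.** $C_n^{\rm gp}(M;\mathbb Z)$ is the free abelian group on $M^n$ for $n\ge1$, and $0$ otherwise. For $n\ge 2$, $$\partial_n^{\rm gp}(m_1,\dots,m_n)=(m_2,\dots,m_n)+\sum_{i=1}^{n-1}(-1)^i(m_1,\dots,m_i+m_{i+1},\dots,m_n)+(-1)^n(m_1,\dots,m_{n-1}),$$ and $\partial_n^{\rm gp}=0$ for $n\le1$. $C_n^{\rm gp}(M;\mathbb Z)_G$ is the quotient by all $(m_1g,\dots,m_ng)-(m_1,\dots,m_n)$, $g\in G$, with the induced boundary map. A group $n$-cocycle is a homomorphism $f:C_n^{\rm gp}(M;\mathbb Z)_G\to A$ with $f\circ\partial_{n+1}^{\rm gp}=0$. **The maps.** $C_n^{\rm BR_U}(X;\mathbb Z)_X$ is, for $n\ge1$, the free abelian group on $G^{n+1}\times M^{n+1}$, with generators written $(g_0,\dots,g_n;m_0,\dots,m_n)$. The homomorphism $\gamma_n:C_n^{\rm BR}(X;\mathbb Z)_X\to C_n^{\rm BR_U}(X;\mathbb Z)_X$ is $$\gamma_n((m_0,g_0),\dots,(m_n,g_n))=(g_0,\dots,g_n;\,m_0-m_1,\,m_1-m_2,\dots,m_{n-1}-m_n,\,m_n).$$ The homomorphism $\psi_n:C_n^{\rm BR_U}(X;\mathbb Z)_X\to C_{n+1}^{\rm gp}(M;\mathbb Z)_G$ is $$\psi_n(g_0,\dots,g_n;m_0,\dots,m_n)=\sum_{k\in\{0,1\}^n}(-1)^{k_1+\cdots+k_n}(m_0\bm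 g_{k,0},m_1\bm g_{k,1},\dots,m_n\bm g_{k,n}),$$ where $k=(k_1,\dots,k_n)$, $\bm g_{k,0}=g_1^{k_1}\cdots g_n^{k_n}$ and $\bm g_{k,i}=\varphi(g_1^{k_1}\cdots g_i^{k_i})\,g_{i+1}^{k_{i+1}}\cdots g_n^{k_n}$ for $1\le i\le n$. *)

theory Defs
  imports "HOL-Algebra.Free_Abelian_Groups" "HOL-Algebra.Module"
begin

subsection \<open>Group rings and right modules\<close>

definition group_center :: "('g, 'b) monoid_scheme \<Rightarrow> 'g set" where
  "group_center G = {z \<in> carrier G. \<forall>g \<in> carrier G. z \<otimes>\<^bsub>G\<^esub> g = g \<otimes>\<^bsub>G\<^esub> z}"

text \<open>The integral group ring: the free abelian group on the elements of \<open>G\<close>, with the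
  biadditive extension of the multiplication of \<open>G\<close>.\<close>

definition group_ring :: "('g, 'b) monoid_scheme \<Rightarrow> ('g \<Rightarrow>\<^sub>0 int) ring" where
  "group_ring G =
    \<lparr>carrier = carrier (free_Abelian_group (carrier G)),
     monoid.mult = (\<lambda>a b. frag_extend (\<lambda>g. frag_extend (\<lambda>h. frag_of (g \<otimes>\<^bsub>G\<^esub> h)) b) a),
     one = frag_of \<one>\<^bsub>G\<^esub>,
     zero = 0,
     add = (+)\<rparr>"

lemma keys_frag_extend_subset:
  assumes "\<And>x. x \<in> Poly_Mapping.keys c \<Longrightarrow> Poly_Mapping.keys (F x) \<subseteq> S"
  shows "Poly_Mapping.keys (frag_extend F c) \<subseteq> S"
  using keys_frag_extend[of F c] assms by blast

lemma frag_extend_add_fun: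
  "frag_extend (\<lambda>x. F x + H x) c = frag_extend F c + frag_extend H c"
  by (simp add: frag_extend_def frag_cmul_distrib2 sum.distrib)

lemma ring_group_ring:
  fixes G (structure)
  assumes "group G"
  shows "ring (group_ring G)"
proof -
  interpret G: group G by fact
  let ?m = "\<lambda>a b. frag_extend (\<lambda>g. frag_extend (\<lambda>h. frag_of (g \<otimes> h)) b) a"
  have closed: "Poly_Mapping.keys (?m a b) \<subseteq> carrier G"
    if "Poly_Mapping.keys a \<subseteq> carrier G" "Poly_Mapping.keys b \<subseteq> carrier G" for a b
    using that by (intro keys_frag_extend_subset) auto
  have ab: "abelian_group (group_ring G)"
  proof (rule abelian_groupI)
    fix x assume "x \<in> carrier (group_ring G)"
    then show "\<exists>y\<in>carrier (group_ring G). y \<oplus>\<^bsub>group_ring G\<^esub> x = \<zero>\<^bsub>group_ring G\<^esub>"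
      by (intro bexI[of _ "- x"]) (auto simp: group_ring_def)
  qed (use keys_add in \<open>fastforce simp: group_ring_def\<close>)+
  have one_l: "?m (frag_of \<one>) a = a" if "Poly_Mapping.keys a \<subseteq> carrier G" for a
    using that by (induction a rule: frag_induction) (auto simp: frag_extend_diff)
  have one_r: "?m a (frag_of \<one>) = a" if "Poly_Mapping.keys a \<subseteq> carrier G" for a
    using that by (induction a rule: frag_induction) (auto simp: frag_extend_diff)
  have mon: "Group.monoid (group_ring G)"
  proof (rule Group.monoidI)
    fix x y z
    assume "x \<in> carrier (group_ring G)" "y \<in> carrier (group_ring G)" "z \<in> carrier (group_ring G)"
    then have "Poly_Mapping.keys x \<subseteq> carrier G" and y: "Poly_Mapping.keys y \<subseteq> carrier G"
      and z: "Poly_Mapping.keys z \<subseteq> carrier G"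
      by (auto simp: group_ring_def)
    from this(1) have "?m (?m x y) z = ?m x (?m y z)"
    proof (induction x rule: frag_induction)
      case (one g)
      have "?m (?m (frag_of g) y) z = ?m (frag_of g) (?m y z)"
        using y
      proof (induction y rule: frag_induction)
        case (one h)
        show ?case
          using z
        proof (induction z rule: frag_induction)
          case (one k)
          then show ?case using \<open>g \<in> carrier G\<close> \<open>h \<in> carrier G\<close> by (simp add: G.m_assoc)
        qed (simp_all add: frag_extend_diff)
      qed (simp_all add: frag_extend_diff)
      then show ?case .
    qed (simp_all add: frag_extend_diff)
    then show "x \<otimes>\<^bsub>group_ring G\<^esub> y \<otimes>\<^bsub>group_ring G\<^esub> z = x \<otimes>\<^bsub>group_ring G\<^esub> (y \<otimes>\<^bsub>group_ring G\<^esub> z)"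
      by (simp add: group_ring_def)
  qed (use closed one_l one_r in \<open>auto simp: group_ring_def\<close>)
  show ?thesis
    by (rule ringI[OF ab mon])
      (simp_all add: group_ring_def frag_extend_add frag_extend_add_fun)
qed

text \<open>The record type \<^typ>\<open>('r, 'm) module\<close> of the library writes scalars on the left. For a right
  module over a possibly noncommutative ring we write the field \<open>r \<odot> m\<close> for \<open>m r\<close>, which
  reverses the order of the factors in \<open>smult_assoc\<close>.\<close>

locale right_module = R?: ring R + M?: abelian_group M for R (structure) and M (structure) +
  assumes smult_closed:
      "\<lbrakk>r \<in> carrier R; x \<in> carrier M\<rbrakk> \<Longrightarrow> r \<odot>\<^bsub>M\<^esub> x \<in> carrier M"
    and smult_scalar_distr:
      "\<lbrakk>r \<in> carrier R; s \<in> carrier R; x \<in> carrier M\<rbrakk> \<Longrightarrow>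
      (r \<oplus> s) \<odot>\<^bsub>M\<^esub> x = r \<odot>\<^bsub>M\<^esub> x \<oplus>\<^bsub>M\<^esub> s \<odot>\<^bsub>M\<^esub> x"
    and smult_vector_distr:
      "\<lbrakk>r \<in> carrier R; x \<in> carrier M; y \<in> carrier M\<rbrakk> \<Longrightarrow>
      r \<odot>\<^bsub>M\<^esub> (x \<oplus>\<^bsub>M\<^esub> y) = r \<odot>\<^bsub>M\<^esub> x \<oplus>\<^bsub>M\<^esub> r \<odot>\<^bsub>M\<^esub> y"
    and smult_assoc:
      "\<lbrakk>r \<in> carrier R; s \<in> carrier R; x \<in> carrier M\<rbrakk> \<Longrightarrow>
      (r \<otimes> s) \<odot>\<^bsub>M\<^esub> x = s \<odot>\<^bsub>M\<^esub> (r \<odot>\<^bsub>M\<^esub> x)"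
    and smult_one:
      "x \<in> carrier M \<Longrightarrow> \<one> \<odot>\<^bsub>M\<^esub> x = x"

abbreviation gact :: "('g \<Rightarrow>\<^sub>0 int, 'm, 'c) module_scheme \<Rightarrow> 'm \<Rightarrow> 'g \<Rightarrow> 'm" where
  "gact M m g \<equiv> frag_of g \<odot>\<^bsub>M\<^esub> m"

subsection \<open>The G-Alexander biquandle and the birack complex\<close>

record 'x birack_ops = "'x partial_object" +
  under_op :: "'x \<Rightarrow> 'x \<Rightarrow> 'x"
  over_op :: "'x \<Rightarrow> 'x \<Rightarrow> 'x"

definition alexander_biquandle ::
  "('g, 'b) monoid_scheme \<Rightarrow> ('g \<Rightarrow>\<^sub>0 int, 'm, 'c) module_scheme \<Rightarrow> ('g \<Rightarrow> 'g) \<Rightarrow> ('m \<times> 'g) birack_ops"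
where
  "alexander_biquandle G M \<phi> =
    \<lparr>carrier = carrier M \<times> carrier G,
     under_op = (\<lambda>(m, g) (n, h).
       (gact M m h \<oplus>\<^bsub>M\<^esub> (frag_of (\<phi> h) \<ominus>\<^bsub>group_ring G\<^esub> frag_of h) \<odot>\<^bsub>M\<^esub> n,
        inv\<^bsub>G\<^esub> h \<otimes>\<^bsub>G\<^esub> g \<otimes>\<^bsub>G\<^esub> h)),
     over_op = (\<lambda>(m, g) (n, h). (gact M m (\<phi> h), g))\<rparr>"

text \<open>A generator \<open>(x\<^sub>0, x\<^sub>1, \<dots>, x\<^sub>n)\<close> of the \<open>n\<close>-th chain group is a list of length \<open>n + 1\<close>; its
  head is the entry in the \<open>X\<close>-set, which here is \<open>X\<close> itself acting by \<open>under_op\<close>. In degree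
  \<open>0\<close> the chain group is the free abelian group on the empty set.\<close>

definition br_gens :: "('x, 'e) birack_ops_scheme \<Rightarrow> nat \<Rightarrow> 'x list set" where
  "br_gens X n = (if n = 0 then {} else {xs. length xs = n + 1 \<and> set xs \<subseteq> carrier X})"

definition br_chain :: "('x, 'e) birack_ops_scheme \<Rightarrow> nat \<Rightarrow> ('x list \<Rightarrow>\<^sub>0 int) monoid" where
  "br_chain X n = free_Abelian_group (br_gens X n)"

definition br_boundary_gen ::
  "('x, 'e) birack_ops_scheme \<Rightarrow> nat \<Rightarrow> 'x list \<Rightarrow> ('x list \<Rightarrow>\<^sub>0 int)"
where
  "br_boundary_gen X n xs =
    (\<Sum>i = 1..n. frag_cmul ((-1) ^ (i - 1))
      (frag_of (take i xs @ drop (i + 1) xs) -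
       frag_of (map (\<lambda>x. under_op X x (xs ! i)) (take i xs) @
                map (\<lambda>x. over_op X x (xs ! i)) (drop (i + 1) xs))))"

definition br_boundary ::
  "('x, 'e) birack_ops_scheme \<Rightarrow> nat \<Rightarrow> ('x list \<Rightarrow>\<^sub>0 int) \<Rightarrow> ('x list \<Rightarrow>\<^sub>0 int)"
where
  "br_boundary X n c = (if n \<le> 1 then 0 else frag_extend (br_boundary_gen X n) c)"

definition birack_cocycle ::
  "('x, 'e) birack_ops_scheme \<Rightarrow> ('a, 'd) monoid_scheme \<Rightarrow> nat \<Rightarrow> (('x list \<Rightarrow>\<^sub>0 int) \<Rightarrow> 'a) \<Rightarrow> bool"
where
  "birack_cocycle X A n \<Phi> \<longleftrightarrow>
    \<Phi> \<in> hom (br_chain X n) A \<and>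
    (\<forall>c \<in> carrier (br_chain X (n + 1)). \<Phi> (br_boundary X (n + 1) c) = \<one>\<^bsub>A\<^esub>)"

subsection \<open>The group complex and its coinvariants\<close>

definition gp_gens :: "('m, 'c) ring_scheme \<Rightarrow> nat \<Rightarrow> 'm list set" where
  "gp_gens M n = (if n = 0 then {} else {ms. length ms = n \<and> set ms \<subseteq> carrier M})"

definition gp_chain :: "('m, 'c) ring_scheme \<Rightarrow> nat \<Rightarrow> ('m list \<Rightarrow>\<^sub>0 int) monoid" where
  "gp_chain M n = free_Abelian_group (gp_gens M n)"

text \<open>List positions start at \<open>0\<close>, so \<open>m\<^sub>i\<close> is \<open>ms ! (i - 1)\<close>.\<close>

definition gp_boundary_gen ::
  "('m, 'c) ring_scheme \<Rightarrow> nat \<Rightarrow> 'm list \<Rightarrow> ('m list \<Rightarrow>\<^sub>0 int)"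
where
  "gp_boundary_gen M n ms =
    frag_of (tl ms) +
    (\<Sum>i = 1..n - 1. frag_cmul ((-1) ^ i)
      (frag_of (take (i - 1) ms @ [ms ! (i - 1) \<oplus>\<^bsub>M\<^esub> ms ! i] @ drop (i + 1) ms))) +
    frag_cmul ((-1) ^ n) (frag_of (butlast ms))"

definition gp_boundary ::
  "('m, 'c) ring_scheme \<Rightarrow> nat \<Rightarrow> ('m list \<Rightarrow>\<^sub>0 int) \<Rightarrow> ('m list \<Rightarrow>\<^sub>0 int)"
where
  "gp_boundary M n c = (if n \<le> 1 then 0 else frag_extend (gp_boundary_gen M n) c)"

definition gp_rel ::
  "('g, 'b) monoid_scheme \<Rightarrow> ('g \<Rightarrow>\<^sub>0 int, 'm, 'c) module_scheme \<Rightarrow> nat \<Rightarrow> ('m list \<Rightarrow>\<^sub>0 int) set"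
where
  "gp_rel G M n = generate (gp_chain M n)
    {frag_of (map (\<lambda>m. gact M m g) ms) - frag_of ms | ms g. ms \<in> gp_gens M n \<and> g \<in> carrier G}"

definition gp_coinv ::
  "('g, 'b) monoid_scheme \<Rightarrow> ('g \<Rightarrow>\<^sub>0 int, 'm, 'c) module_scheme \<Rightarrow> nat \<Rightarrow> ('m list \<Rightarrow>\<^sub>0 int) set monoid"
where
  "gp_coinv G M n = gp_chain M n Mod gp_rel G M n"

definition gp_proj ::
  "('g, 'b) monoid_scheme \<Rightarrow> ('g \<Rightarrow>\<^sub>0 int, 'm, 'c) module_scheme \<Rightarrow> nat \<Rightarrow>
    ('m list \<Rightarrow>\<^sub>0 int) \<Rightarrow> ('m list \<Rightarrow>\<^sub>0 int) set"
where
  "gp_proj G M n c = gp_rel G M n #>\<^bsub>gp_chain M n\<^esub> c"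

text \<open>The induced boundary map sends the class of \<open>c\<close> to the class of the boundary of \<open>c\<close>. All
  representatives of a class yield the same value, so the union below is over equal cosets.\<close>

definition gp_coinv_boundary ::
  "('g, 'b) monoid_scheme \<Rightarrow> ('g \<Rightarrow>\<^sub>0 int, 'm, 'c) module_scheme \<Rightarrow> nat \<Rightarrow>
    ('m list \<Rightarrow>\<^sub>0 int) set \<Rightarrow> ('m list \<Rightarrow>\<^sub>0 int) set"
where
  "gp_coinv_boundary G M n K = (\<Union>c \<in> K. gp_proj G M (n - 1) (gp_boundary M n c))"

definition group_cocycle ::
  "('g, 'b) monoid_scheme \<Rightarrow> ('g \<Rightarrow>\<^sub>0 int, 'm, 'c) module_scheme \<Rightarrow> ('a, 'd) monoid_scheme \<Rightarrow> nat \<Rightarrow>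
    (('m list \<Rightarrow>\<^sub>0 int) set \<Rightarrow> 'a) \<Rightarrow> bool"
where
  "group_cocycle G M A n f \<longleftrightarrow>
    f \<in> hom (gp_coinv G M n) A \<and>
    (\<forall>K \<in> carrier (gp_coinv G M (n + 1)). f (gp_coinv_boundary G M (n + 1) K) = \<one>\<^bsub>A\<^esub>)"

subsection \<open>The maps gamma and psi\<close>

text \<open>A generator \<open>(g\<^sub>0, \<dots>, g\<^sub>n; m\<^sub>0, \<dots>, m\<^sub>n)\<close> of the intermediate chain group is a pair of
  lists of length \<open>n + 1\<close>.\<close>

definition gamma ::
  "('m, 'c) ring_scheme \<Rightarrow> nat \<Rightarrow> (('m \<times> 'g) list \<Rightarrow>\<^sub>0 int) \<Rightarrow> ('g list \<times> 'm list \<Rightarrow>\<^sub>0 int)"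
where
  "gamma M n = frag_extend (\<lambda>xs. frag_of
    (map snd xs,
     map (\<lambda>i. fst (xs ! i) \<ominus>\<^bsub>M\<^esub> fst (xs ! (i + 1))) [0..<n] @ [fst (xs ! n)]))"

text \<open>\<open>kprod G gs k a b\<close> is the ordered product of the powers \<open>g\<^sub>i ^ k\<^sub>i\<close> for \<open>a \<le> i \<le> b\<close>.\<close>

definition kprod :: "('g, 'b) monoid_scheme \<Rightarrow> 'g list \<Rightarrow> (nat \<Rightarrow> nat) \<Rightarrow> nat \<Rightarrow> nat \<Rightarrow> 'g" where
  "kprod G gs k a b = foldr (\<lambda>i p. gs ! i [^]\<^bsub>G\<^esub> k i \<otimes>\<^bsub>G\<^esub> p) [a..<b + 1] \<one>\<^bsub>G\<^esub>"

definition gk :: "('g, 'b) monoid_scheme \<Rightarrow> ('g \<Rightarrow> 'g) \<Rightarrow> nat \<Rightarrow> 'g list \<Rightarrow> (nat \<Rightarrow> nat) \<Rightarrow> nat \<Rightarrow> 'g" where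
  "gk G \<phi> n gs k i =
    (if i = 0 then kprod G gs k 1 n
     else \<phi> (kprod G gs k 1 i) \<otimes>\<^bsub>G\<^esub> kprod G gs k (i + 1) n)"

definition psi_gen ::
  "('g, 'b) monoid_scheme \<Rightarrow> ('g \<Rightarrow>\<^sub>0 int, 'm, 'c) module_scheme \<Rightarrow> ('g \<Rightarrow> 'g) \<Rightarrow> nat \<Rightarrow>
    'g list \<times> 'm list \<Rightarrow> ('m list \<Rightarrow>\<^sub>0 int)"
where
  "psi_gen G M \<phi> n = (\<lambda>(gs, ms).
    \<Sum>k \<in> {1..n} \<rightarrow>\<^sub>E {0, 1}. frag_cmul ((-1) ^ (\<Sum>i = 1..n. k i))
      (frag_of (map (\<lambda>i. gact M (ms ! i) (gk G \<phi> n gs k i)) [0..<n + 1])))"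

definition psi ::
  "('g, 'b) monoid_scheme \<Rightarrow> ('g \<Rightarrow>\<^sub>0 int, 'm, 'c) module_scheme \<Rightarrow> ('g \<Rightarrow> 'g) \<Rightarrow> nat \<Rightarrow>
    ('g list \<times> 'm list \<Rightarrow>\<^sub>0 int) \<Rightarrow> ('m list \<Rightarrow>\<^sub>0 int) set"
where
  "psi G M \<phi> n c = gp_proj G M (n + 1) (frag_extend (psi_gen G M \<phi> n) c)"

end

theory Submission
  imports Defs
begin

text \<open>Write \<open>\<partial>\<close> for both boundary maps. The proof shows that \<open>\<psi> \<gamma> \<partial> = - \<partial> \<psi> \<gamma>\<close>
  in the coinvariants of the group complex (\<open>prism_boundary_chain\<close>). A group cocycle \<open>f\<close>
  kills the right-hand side, hence \<open>f \<psi> \<gamma> \<partial> = 0\<close>.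

  The image of a generator \<open>xs = ((m\<^sub>0, g\<^sub>0), \<dots>)\<close> of degree \<open>n + 1\<close> under \<open>\<psi> \<gamma>\<close> is a signed
  sum of simplices indexed by the vertices \<open>k\<close> of a cube of dimension \<open>n + 1\<close>. The entry of index
  \<open>j\<close> of such a simplex is the difference \<open>m\<^sub>j - m\<^sub>j\<^sub>+\<^sub>1\<close> (or \<open>m\<^sub>n\<^sub>+\<^sub>1\<close> for the last one),
  acted on by the factor \<open>gk\<close>. The group boundary has three kinds of terms.

  The face that adds the entries of index \<open>i - 1\<close> and \<open>i\<close> telescopes the differences. If
  \<open>k\<^sub>i = 0\<close>, both entries carry the same group element, and the result is the simplex of \<open>xs\<close>
  with \<open>x\<^sub>i\<close> deleted. If \<open>k\<^sub>i = 1\<close>, the two entries carry the additional factors \<open>g\<^sub>i\<close> and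
  \<open>\<phi> g\<^sub>i\<close>, and the result is the simplex of \<open>xs\<close> with \<open>x\<^sub>i\<close> deleted and acting on the other
  entries by the biquandle operations: the term \<open>n (\<phi> h - h)\<close> of the lower operation is
  exactly the discrepancy between the two factors, and the conjugation in the second component
  moves \<open>g\<^sub>i\<close> past the elements to its left. So the vertices with \<open>k\<^sub>i = 0\<close> and
  \<open>k\<^sub>i = 1\<close> produce the two terms of the birack boundary with index \<open>i\<close>. This is
  \<open>simplex_face\<close>.

  The first face forgets the entry of index \<open>0\<close>. In all others \<open>g\<^sub>1\<close> occurs only through the
  central factor \<open>\<phi> g\<^sub>1\<close>, so that the simplices for \<open>k\<^sub>1 = 0\<close> and \<open>k\<^sub>1 = 1\<close> differ by the
  action of one group element and cancel in the coinvariants (\<open>tl_simplex\<close>). The last face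
  vanishes likewise, since in all entries but the last \<open>g\<^sub>n\<^sub>+\<^sub>1\<close> occurs as the rightmost factor
  (\<open>butlast_simplex\<close>).\<close>

section \<open>Splitting a sum over the cube at one coordinate\<close>

text \<open>Inserting a coordinate \<open>e\<close> at position \<open>i\<close> identifies a cube with the facet
  \<open>k\<^sub>i = e\<close> of a cube of the next dimension.\<close>

definition cube_insert :: "nat \<Rightarrow> nat \<Rightarrow> nat \<Rightarrow> (nat \<Rightarrow> nat) \<Rightarrow> nat \<Rightarrow> nat" where
  "cube_insert n i e k = (\<lambda>j \<in> {1..n + 1}. if j < i then k j else if j = i then e else k (j - 1))"

lemma sum_cube_split:
  fixes F :: "(nat \<Rightarrow> nat) \<Rightarrow> 'a :: comm_monoid_add"
  assumes i: "1 \<le> i" "i \<le> n + 1"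
  shows "(\<Sum>k \<in> {1..n + 1} \<rightarrow>\<^sub>E {0, 1}. F k) =
    (\<Sum>k \<in> {1..n} \<rightarrow>\<^sub>E {0, 1}. F (cube_insert n i 0 k) + F (cube_insert n i 1 k))"
proof -
  define del :: "(nat \<Rightarrow> nat) \<Rightarrow> nat \<Rightarrow> nat"
    where "del k = (\<lambda>j \<in> {1..n}. if j < i then k j else k (j + 1))" for k
  have "(\<Sum>k \<in> {1..n + 1} \<rightarrow>\<^sub>E {0, 1}. F k) =
    (\<Sum>(k, e) \<in> ({1..n} \<rightarrow>\<^sub>E {0, 1}) \<times> {0, 1}. F (cube_insert n i e k))"
  proof (rule sum.reindex_bij_witness[of _ "\<lambda>(k, e). cube_insert n i e k" "\<lambda>k. (del k, k i)"])
    fix k :: "nat \<Rightarrow> nat" assume k: "k \<in> {1..n + 1} \<rightarrow>\<^sub>E {0, 1}"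
    have "cube_insert n i (k i) (del k) = k"
    proof
      fix j
      show "cube_insert n i (k i) (del k) j = k j"
        using i PiE_arb[OF k, of j] by (auto simp: cube_insert_def del_def)
    qed
    then show "(case (del k, k i) of (k, e) \<Rightarrow> cube_insert n i e k) = k"
      and "(case (del k, k i) of (k, e) \<Rightarrow> F (cube_insert n i e k)) = F k"
      by simp_all
    have kv: "k j \<in> {0, 1}" if "1 \<le> j" "j \<le> n + 1" for j
      using PiE_mem[OF k] that by simp
    have "k i \<in> {0, 1}"
      using kv i by blast
    moreover have "del k \<in> {1..n} \<rightarrow>\<^sub>E {0, 1}"
      unfolding del_def
    proof (intro restrict_PiE_iff[THEN iffD2] ballI)
      fix j assume "j \<in> {1..n}"
      then show "(if j < i then k j else k (j + 1)) \<in> {0, 1}"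
        using kv[of j] kv[of "j + 1"] by auto
    qed
    ultimately show "(del k, k i) \<in> ({1..n} \<rightarrow>\<^sub>E {0, 1}) \<times> {0, 1}"
      by simp
  next
    fix p :: "(nat \<Rightarrow> nat) \<times> nat" assume "p \<in> ({1..n} \<rightarrow>\<^sub>E {0, 1}) \<times> {0, 1}"
    then obtain k e where p: "p = (k, e)" and k: "k \<in> {1..n} \<rightarrow>\<^sub>E {0, 1}" and e: "e \<in> {0, 1}"
      by auto
    have "del (cube_insert n i e k) = k"
    proof
      fix j
      show "del (cube_insert n i e k) j = k j"
        using i PiE_arb[OF k, of j] by (auto simp: cube_insert_def del_def)
    qed
    moreover have "cube_insert n i e k i = e"
      using i by (simp add: cube_insert_def)
    ultimately show "(del (case p of (k, e) \<Rightarrow> cube_insert n i e k),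
        (case p of (k, e) \<Rightarrow> cube_insert n i e k) i) = p"
      by (simp add: p)
    have kv: "k j \<in> {0, 1}" if "1 \<le> j" "j \<le> n" for j
      using PiE_mem[OF k] that by simp
    have "cube_insert n i e k \<in> {1..n + 1} \<rightarrow>\<^sub>E {0, 1}"
      unfolding cube_insert_def
    proof (intro restrict_PiE_iff[THEN iffD2] ballI)
      fix j assume "j \<in> {1..n + 1}"
      then show "(if j < i then k j else if j = i then e else k (j - 1)) \<in> {0, 1}"
        using i e kv[of j] kv[of "j - 1"] by auto
    qed
    then show "(case p of (k, e) \<Rightarrow> cube_insert n i e k) \<in> {1..n + 1} \<rightarrow>\<^sub>E {0, 1}"
      by (simp add: p)
  qed
  also have "\<dots> = (\<Sum>k \<in> {1..n} \<rightarrow>\<^sub>E {0, 1}. \<Sum>e \<in> {0, 1}. F (cube_insert n i e k))"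
    by (rule sum.cartesian_product[symmetric])
  finally show ?thesis by simp
qed

lemma sum_cube_insert:
  assumes "1 \<le> i" "i \<le> n + 1"
  shows "(\<Sum>j = 1..n + 1. cube_insert n i e k j) = e + (\<Sum>j = 1..n. k j)"
proof -
  have "{1..n + 1} = {1..<i} \<union> {i} \<union> {i + 1..<n + 2}" using assms by auto
  then have "(\<Sum>j = 1..n + 1. cube_insert n i e k j) =
      (\<Sum>j \<in> {1..<i} \<union> {i} \<union> {i + 1..<n + 2}. cube_insert n i e k j)"
    by simp
  also have "\<dots> = (\<Sum>j = 1..<i. cube_insert n i e k j) + cube_insert n i e k i +
      (\<Sum>j = i + 1..<n + 2. cube_insert n i e k j)"
    by (subst sum.union_disjoint; (subst sum.union_disjoint)?) auto
  also have "(\<Sum>j = i + 1..<n + 2. cube_insert n i e k j) = (\<Sum>j = i..<n + 1. k j)"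
    using sum.shift_bounds_nat_ivl[of "cube_insert n i e k" i 1 "n + 1"]
    by (auto simp: cube_insert_def intro!: sum.cong)
  also have "(\<Sum>j = 1..<i. cube_insert n i e k j) = (\<Sum>j = 1..<i. k j)"
    using assms by (auto simp: cube_insert_def intro!: sum.cong)
  also have "cube_insert n i e k i = e"
    using assms by (simp add: cube_insert_def)
  also have "(\<Sum>j = 1..<i. k j) + e + (\<Sum>j = i..<n + 1. k j) = e + (\<Sum>j = 1..<n + 1. k j)"
    using sum.atLeastLessThan_concat[of 1 i "n + 1" k] assms by simp
  also have "{1..<n + 1} = {1..n}" by auto
  finally show ?thesis by simp
qed

section \<open>Ordered products of powers\<close>

context group
begin

lemma foldr_mult_closed:
  assumes "\<And>j. j \<in> set js \<Longrightarrow> p j \<in> carrier G"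
  shows "foldr (\<lambda>j q. p j \<otimes> q) js \<one> \<in> carrier G"
  using assms by (induction js) auto

lemma foldr_mult_append:
  assumes "\<And>j. j \<in> set (is @ js) \<Longrightarrow> p j \<in> carrier G"
  shows "foldr (\<lambda>j q. p j \<otimes> q) (is @ js) \<one> =
    foldr (\<lambda>j q. p j \<otimes> q) is \<one> \<otimes> foldr (\<lambda>j q. p j \<otimes> q) js \<one>"
  using assms by (induction "is") (auto simp: foldr_mult_closed m_assoc)

lemma nth_in_carrier: "set gs \<subseteq> carrier G \<Longrightarrow> j < length gs \<Longrightarrow> gs ! j \<in> carrier G"
  using nth_mem by blast

lemma kprod_closed:
  assumes "set gs \<subseteq> carrier G" "b < length gs"
  shows "kprod G gs k a b \<in> carrier G"
  unfolding kprod_def using assms by (intro foldr_mult_closed) (auto intro!: nth_in_carrier)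

lemma kprod_empty: "kprod G gs k (b + 1) b = \<one>"
  by (simp add: kprod_def)

lemma kprod_single:
  assumes "set gs \<subseteq> carrier G" "a < length gs"
  shows "kprod G gs k a a = gs ! a [^] k a"
proof -
  have "gs ! a \<in> carrier G" using assms nth_mem by blast
  then show ?thesis by (simp add: kprod_def)
qed

lemma kprod_split:
  assumes gs: "set gs \<subseteq> carrier G" "c < length gs" and ab: "a \<le> b + 1" "b \<le> c"
  shows "kprod G gs k a c = kprod G gs k a b \<otimes> kprod G gs k (b + 1) c"
proof -
  have "[a..<c + 1] = [a..<b + 1] @ [b + 1..<c + 1]"
    using upt_add_eq_append[of a "b + 1" "c - b"] ab by simp
  moreover have "gs ! j \<in> carrier G" if "j < c + 1" for j
    using gs that by (auto intro!: nth_in_carrier)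
  ultimately show ?thesis
    unfolding kprod_def using ab by (simp only:) (intro foldr_mult_append, auto)
qed

lemma kprod_cong:
  assumes "\<And>j. a \<le> j \<Longrightarrow> j \<le> b \<Longrightarrow> gs ! j [^] k j = gs' ! j [^] k' j"
  shows "kprod G gs k a b = kprod G gs' k' a b"
  unfolding kprod_def using assms by (intro foldr_cong) auto

lemma kprod_shift:
  assumes "\<And>j. a \<le> j \<Longrightarrow> j \<le> b \<Longrightarrow> gs ! j [^] k j = gs' ! (j + 1) [^] k' (j + 1)"
  shows "kprod G gs k a b = kprod G gs' k' (a + 1) (b + 1)"
proof -
  have "[a + 1..<b + 1 + 1] = map Suc [a..<b + 1]"
    by (simp only: map_Suc_upt Suc_eq_plus1)
  then show ?thesis
    unfolding kprod_def using assms
    by (simp only: foldr_map o_def) (intro foldr_cong, auto)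
qed

lemma pow_intertwine:
  assumes "h \<in> carrier G" "x \<in> carrier G" "y \<in> carrier G" "h \<otimes> x = y \<otimes> h"
  shows "h \<otimes> x [^] (m :: nat) = y [^] m \<otimes> h"
proof (induction m)
  case (Suc m)
  have "h \<otimes> x [^] Suc m = (h \<otimes> x [^] m) \<otimes> x" using assms by (simp add: m_assoc)
  also have "\<dots> = y [^] m \<otimes> (h \<otimes> x)" using assms Suc by (simp add: m_assoc)
  also have "\<dots> = y [^] Suc m \<otimes> h" using assms by (simp add: m_assoc)
  finally show ?case .
qed (use assms in simp)

lemma foldr_mult_intertwine:
  assumes h: "h \<in> carrier G"
    and "\<And>j. j \<in> set js \<Longrightarrow> p j \<in> carrier G \<and> q j \<in> carrier G \<and> h \<otimes> p j = q j \<otimes> h"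
  shows "h \<otimes> foldr (\<lambda>j r. p j \<otimes> r) js \<one> = foldr (\<lambda>j r. q j \<otimes> r) js \<one> \<otimes> h"
  using assms(2)
proof (induction js)
  case (Cons j js)
  let ?P = "foldr (\<lambda>j r. p j \<otimes> r) js \<one>" and ?Q = "foldr (\<lambda>j r. q j \<otimes> r) js \<one>"
  have cl: "?P \<in> carrier G" "?Q \<in> carrier G" "p j \<in> carrier G" "q j \<in> carrier G"
    using Cons.prems by (auto intro: foldr_mult_closed)
  have "h \<otimes> (p j \<otimes> ?P) = (h \<otimes> p j) \<otimes> ?P" using cl h by (simp add: m_assoc)
  also have "\<dots> = q j \<otimes> (h \<otimes> ?P)" using cl h Cons.prems by (simp add: m_assoc)
  also have "\<dots> = q j \<otimes> ?Q \<otimes> h" using cl h Cons by (simp add: m_assoc)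
  finally show ?case by simp
qed (use h in simp)

text \<open>Conjugation by \<open>h\<close> is written as \<open>h x = y h\<close>, so that no inverse occurs in the products.\<close>

lemma kprod_intertwine:
  assumes "h \<in> carrier G" "set gs \<subseteq> carrier G" "set gs' \<subseteq> carrier G"
    and "b < length gs" "b < length gs'"
    and "\<And>j. a \<le> j \<Longrightarrow> j \<le> b \<Longrightarrow> h \<otimes> gs' ! j = gs ! j \<otimes> h \<and> k' j = k j"
  shows "h \<otimes> kprod G gs' k' a b = kprod G gs k a b \<otimes> h"
  unfolding kprod_def
proof (rule foldr_mult_intertwine)
  fix j assume "j \<in> set [a..<b + 1]"
  then have j: "a \<le> j" "j \<le> b" by auto
  with assms have "gs ! j \<in> carrier G" "gs' ! j \<in> carrier G"
    by (meson le_less_trans nth_mem subsetD)+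
  then show "gs' ! j [^] k' j \<in> carrier G \<and> gs ! j [^] k j \<in> carrier G \<and>
      h \<otimes> gs' ! j [^] k' j = gs ! j [^] k j \<otimes> h"
    using assms(1) assms(6)[OF j] by (auto intro: pow_intertwine)
qed (fact assms)

end

section \<open>The action on the module and the group factors of the entries\<close>

locale alexander_module = G: group G + M: right_module "group_ring G" M
  for G :: "('g, 'b) monoid_scheme" (structure)
    and M :: "('g \<Rightarrow>\<^sub>0 int, 'm, 'c) module_scheme" +
  fixes \<phi> :: "'g \<Rightarrow> 'g"
  assumes phi: "\<phi> \<in> hom G (G\<lparr>carrier := group_center G\<rparr>)"
begin

lemma phi_closed [simp]: "g \<in> carrier G \<Longrightarrow> \<phi> g \<in> carrier G"
  and phi_central: "g \<in> carrier G \<Longrightarrow> h \<in> carrier G \<Longrightarrow> \<phi> g \<otimes> h = h \<otimes> \<phi> g"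
  and phi_mult: "g \<in> carrier G \<Longrightarrow> h \<in> carrier G \<Longrightarrow> \<phi> (g \<otimes> h) = \<phi> g \<otimes> \<phi> h"
proof -
  have "\<phi> x \<in> group_center G" if "x \<in> carrier G" for x
    using hom_in_carrier[OF phi that] by simp
  then show "g \<in> carrier G \<Longrightarrow> \<phi> g \<in> carrier G"
    and "g \<in> carrier G \<Longrightarrow> h \<in> carrier G \<Longrightarrow> \<phi> g \<otimes> h = h \<otimes> \<phi> g"
    by (simp_all add: group_center_def)
  show "g \<in> carrier G \<Longrightarrow> h \<in> carrier G \<Longrightarrow> \<phi> (g \<otimes> h) = \<phi> g \<otimes> \<phi> h"
    using hom_mult[OF phi] by simp
qed

lemma phi_one [simp]: "\<phi> \<one> = \<one>"
  using phi_mult[of \<one> \<one>] phi_closed[of \<one>] by simp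

lemma frag_of_in_group_ring [simp]: "g \<in> carrier G \<Longrightarrow> frag_of g \<in> carrier (group_ring G)"
  by (simp add: group_ring_def)

lemma act_closed [simp]: "g \<in> carrier G \<Longrightarrow> m \<in> carrier M \<Longrightarrow> gact M m g \<in> carrier M"
  by (simp add: M.smult_closed)

lemma act_one [simp]: "m \<in> carrier M \<Longrightarrow> gact M m \<one> = m"
  using M.smult_one by (simp add: group_ring_def)

lemma act_mult:
  assumes "g \<in> carrier G" "h \<in> carrier G" "m \<in> carrier M"
  shows "gact M (gact M m g) h = gact M m (g \<otimes> h)"
  using M.smult_assoc[of "frag_of g" "frag_of h" m] assms by (simp add: group_ring_def)

lemma act_add:
  "g \<in> carrier G \<Longrightarrow> x \<in> carrier M \<Longrightarrow> y \<in> carrier M \<Longrightarrow>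
    gact M (x \<oplus>\<^bsub>M\<^esub> y) g = gact M x g \<oplus>\<^bsub>M\<^esub> gact M y g"
  by (simp add: M.smult_vector_distr)

lemma diff_eq_iff:
  assumes "x \<in> carrier M" "y \<in> carrier M" "z \<in> carrier M"
  shows "x \<ominus>\<^bsub>M\<^esub> y = z \<longleftrightarrow> x = z \<oplus>\<^bsub>M\<^esub> y"
  unfolding a_minus_def using assms
  by (auto simp: M.M.a_assoc M.M.l_neg M.M.r_neg)

lemma act_diff:
  assumes "g \<in> carrier G" "x \<in> carrier M" "y \<in> carrier M"
  shows "gact M (x \<ominus>\<^bsub>M\<^esub> y) g = gact M x g \<ominus>\<^bsub>M\<^esub> gact M y g"
proof -
  have "gact M x g = gact M (x \<ominus>\<^bsub>M\<^esub> y) g \<oplus>\<^bsub>M\<^esub> gact M y g"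
    using assms diff_eq_iff[of x y "x \<ominus>\<^bsub>M\<^esub> y"]
      act_add[of g "x \<ominus>\<^bsub>M\<^esub> y" y] M.M.minus_closed by metis
  then show ?thesis
    using assms diff_eq_iff[of "gact M x g" "gact M y g" "gact M (x \<ominus>\<^bsub>M\<^esub> y) g"] act_closed
      M.M.minus_closed by metis
qed

lemma act_scalar_diff:
  assumes "g \<in> carrier G" "h \<in> carrier G" "x \<in> carrier M"
  shows "(frag_of g \<ominus>\<^bsub>group_ring G\<^esub> frag_of h) \<odot>\<^bsub>M\<^esub> x = gact M x g \<ominus>\<^bsub>M\<^esub> gact M x h"
proof -
  let ?R = "group_ring G"
  have gh: "frag_of g \<in> carrier ?R" "frag_of h \<in> carrier ?R" using assms by auto
  then have d: "frag_of g \<ominus>\<^bsub>?R\<^esub> frag_of h \<in> carrier ?R" by simp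
  have "(frag_of g \<ominus>\<^bsub>?R\<^esub> frag_of h) \<oplus>\<^bsub>?R\<^esub> frag_of h = frag_of g"
    using gh by (simp add: a_minus_def M.R.a_assoc M.R.l_neg)
  then have "gact M x g = (frag_of g \<ominus>\<^bsub>?R\<^esub> frag_of h) \<odot>\<^bsub>M\<^esub> x \<oplus>\<^bsub>M\<^esub> gact M x h"
    using M.smult_scalar_distr[OF d gh(2) assms(3)] by simp
  then show ?thesis
    using assms d act_closed M.smult_closed diff_eq_iff by metis
qed

text \<open>Conjugate elements have the same image under a homomorphism into the center.\<close>

lemma phi_eq_if_intertwined:
  assumes "h \<in> carrier G" "x \<in> carrier G" "y \<in> carrier G" "h \<otimes> x = y \<otimes> h"
  shows "\<phi> x = \<phi> y"
proof -
  have "\<phi> h \<otimes> \<phi> x = \<phi> h \<otimes> \<phi> y"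
    using assms phi_mult[of h x] phi_mult[of y h] phi_central[of y "\<phi> h"] by simp
  then show ?thesis using assms by simp
qed

text \<open>The two cases in the definition of \<open>gk\<close> agree, as \<open>\<phi>\<close> maps the empty product to the
  neutral element.\<close>

lemma gk_eq:
  assumes "set gs \<subseteq> carrier G" "n < length gs"
  shows "gk G \<phi> n gs k j = \<phi> (kprod G gs k 1 j) \<otimes> kprod G gs k (j + 1) n"
  using assms G.kprod_empty[of gs k 0] by (auto simp: gk_def G.kprod_closed)

lemma gk_closed:
  assumes "set gs \<subseteq> carrier G" "n < length gs" "j \<le> n"
  shows "gk G \<phi> n gs k j \<in> carrier G"
  using assms by (simp add: gk_eq G.kprod_closed)

context
  fixes gs gs' :: "'g list" and n i e :: nat and k :: "nat \<Rightarrow> nat"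
  assumes gs: "set gs \<subseteq> carrier G" "length gs = n + 2"
    and gs': "set gs' \<subseteq> carrier G" "length gs' = n + 1"
    and i: "1 \<le> i" "i \<le> n + 1"
    and below: "\<And>j. 1 \<le> j \<Longrightarrow> j < i \<Longrightarrow> gs ! i [^] e \<otimes> gs' ! j = gs ! j \<otimes> gs ! i [^] e"
    and above: "\<And>j. i \<le> j \<Longrightarrow> j \<le> n \<Longrightarrow> gs' ! j = gs ! (j + 1)"
begin

text \<open>Here \<open>gs'\<close> consists of the second components of a face of the birack: with \<open>h\<close> the power
  \<open>e\<close> of the entry of \<open>gs\<close> at \<open>i\<close>, this entry is deleted and the entries before it are
  conjugated by \<open>h\<close>. The products \<open>kprod\<close> start at index \<open>1\<close>, hence the lower bound in
  \<open>below\<close>, which \<open>tl_simplex\<close> relies on.\<close>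

lemma kprod_face_below:
  assumes "1 \<le> a" "b < i"
  shows "gs ! i [^] e \<otimes> kprod G gs' k a b = kprod G gs (cube_insert n i e k) a b \<otimes> gs ! i [^] e"
  using gs gs' i assms below
  by (intro G.kprod_intertwine) (auto simp: cube_insert_def G.nth_in_carrier)

lemma kprod_face_above:
  assumes "i \<le> a" "b \<le> n"
  shows "kprod G gs' k a b = kprod G gs (cube_insert n i e k) (a + 1) (b + 1)"
  using i assms above by (intro G.kprod_shift) (auto simp: cube_insert_def)

lemma phi_kprod_face_below:
  assumes "1 \<le> a" "b < i"
  shows "\<phi> (kprod G gs' k a b) = \<phi> (kprod G gs (cube_insert n i e k) a b)"
  using gs gs' i assms kprod_face_below[OF assms]
  by (intro phi_eq_if_intertwined[of "gs ! i [^] e"]) (auto simp: G.nth_in_carrier G.kprod_closed)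

lemma kprod_at_face: "kprod G gs (cube_insert n i e k) i i = gs ! i [^] e"
  using gs i by (subst G.kprod_single) (auto simp: cube_insert_def)

text \<open>An entry before the deleted position contains \<open>h\<close> inside its product. Moving the factor
  \<open>h\<close> in from the left undoes the conjugations on its way.\<close>

lemma gk_face_below:
  assumes j: "j < i"
  shows "gs ! i [^] e \<otimes> gk G \<phi> n gs' k j = gk G \<phi> (n + 1) gs (cube_insert n i e k) j"
proof -
  let ?h = "gs ! i [^] e" and ?K = "cube_insert n i e k"
  have h: "?h \<in> carrier G" using gs i by (simp add: G.nth_in_carrier)
  have cl': "kprod G gs' k a b \<in> carrier G" if "b \<le> n" for a b
    using gs' that by (intro G.kprod_closed) auto
  have cl: "kprod G gs ?K a b \<in> carrier G" if "b \<le> n + 1" for a b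
    using gs that by (intro G.kprod_closed) auto
  define A B B' C where "A = \<phi> (kprod G gs ?K 1 j)" and "B = kprod G gs ?K (j + 1) (i - 1)"
    and "B' = kprod G gs' k (j + 1) (i - 1)" and "C = kprod G gs ?K (i + 1) (n + 1)"
  have ABC: "A \<in> carrier G" "B \<in> carrier G" "B' \<in> carrier G" "C \<in> carrier G"
    using i j by (auto simp: A_def B_def B'_def C_def cl cl')
  have "kprod G gs' k (j + 1) n = B' \<otimes> kprod G gs' k i n"
    using G.kprod_split[of gs' n "j + 1" "i - 1" k] gs' i j by (simp add: B'_def)
  also have "kprod G gs' k i n = C"
    using kprod_face_above[of i n] by (simp add: C_def)
  finally have 1: "gk G \<phi> n gs' k j = A \<otimes> (B' \<otimes> C)"
    using gs' j phi_kprod_face_below[of 1 j] by (simp add: gk_eq A_def)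
  have "kprod G gs ?K (j + 1) (n + 1) = B \<otimes> kprod G gs ?K i (n + 1)"
    using G.kprod_split[of gs "n + 1" "j + 1" "i - 1" ?K] gs i j by (simp add: B_def)
  also have "kprod G gs ?K i (n + 1) = ?h \<otimes> C"
    using G.kprod_split[of gs "n + 1" i i ?K] gs i kprod_at_face by (simp add: C_def)
  finally have 2: "gk G \<phi> (n + 1) gs ?K j = A \<otimes> (B \<otimes> (?h \<otimes> C))"
    using gs by (simp add: gk_eq A_def)
  have hA: "?h \<otimes> A = A \<otimes> ?h"
    unfolding A_def using h cl i j by (simp add: phi_central)
  have hB: "?h \<otimes> B' = B \<otimes> ?h"
    unfolding B_def B'_def using i j by (intro kprod_face_below) auto
  have "?h \<otimes> (A \<otimes> (B' \<otimes> C)) = (?h \<otimes> A) \<otimes> (B' \<otimes> C)" using h ABC by (simp add: G.m_assoc)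
  also have "\<dots> = A \<otimes> ((?h \<otimes> B') \<otimes> C)" using h ABC by (simp add: hA G.m_assoc)
  also have "\<dots> = A \<otimes> (B \<otimes> (?h \<otimes> C))" using h ABC by (simp add: hB G.m_assoc)
  finally show ?thesis by (simp only: 1 2)
qed

text \<open>An entry of \<open>gs\<close> after the deleted position contains \<open>h\<close> only through the central
  element \<open>\<phi> h\<close>. The index \<open>j = i - 1\<close> is covered by this lemma and by \<open>gk_face_below\<close>: it is
  the position of the merged entry, both of whose summands have to be compared.\<close>

lemma gk_face_above:
  assumes j: "i \<le> j + 1" "j \<le> n"
  shows "\<phi> (gs ! i [^] e) \<otimes> gk G \<phi> n gs' k j = gk G \<phi> (n + 1) gs (cube_insert n i e k) (j + 1)"
proof -
  let ?h = "gs ! i [^] e" and ?K = "cube_insert n i e k"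
  have h: "?h \<in> carrier G" using gs i by (simp add: G.nth_in_carrier)
  have cl': "kprod G gs' k a b \<in> carrier G" if "b \<le> n" for a b
    using gs' that by (intro G.kprod_closed) auto
  have cl: "kprod G gs ?K a b \<in> carrier G" if "b \<le> n + 1" for a b
    using gs that by (intro G.kprod_closed) auto
  define P Q R where "P = kprod G gs ?K 1 (i - 1)" and "Q = kprod G gs ?K (i + 1) (j + 1)"
    and "R = kprod G gs ?K (j + 2) (n + 1)"
  have PQR: "P \<in> carrier G" "Q \<in> carrier G" "R \<in> carrier G"
    using i j by (auto simp: P_def Q_def R_def cl)
  have "kprod G gs' k 1 j = kprod G gs' k 1 (i - 1) \<otimes> kprod G gs' k i j"
    using G.kprod_split[of gs' j 1 "i - 1" k] gs' i j by simp
  then have "\<phi> (kprod G gs' k 1 j) = \<phi> (kprod G gs' k 1 (i - 1)) \<otimes> \<phi> (kprod G gs' k i j)"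
    using i j by (simp add: phi_mult cl')
  also have "\<dots> = \<phi> P \<otimes> \<phi> Q"
    using phi_kprod_face_below[of 1 "i - 1"] kprod_face_above[of i j] i j
    by (simp add: P_def Q_def)
  finally have 1: "gk G \<phi> n gs' k j = \<phi> P \<otimes> \<phi> Q \<otimes> R"
    using gs' i j kprod_face_above[of "j + 1" n] by (simp add: gk_eq R_def)
  have "kprod G gs ?K 1 (j + 1) = P \<otimes> kprod G gs ?K i (j + 1)"
    using G.kprod_split[of gs "j + 1" 1 "i - 1" ?K] gs i j by (simp add: P_def)
  also have "kprod G gs ?K i (j + 1) = ?h \<otimes> Q"
    using G.kprod_split[of gs "j + 1" i i ?K] gs i j kprod_at_face by (simp add: Q_def)
  finally have "\<phi> (kprod G gs ?K 1 (j + 1)) = \<phi> P \<otimes> (\<phi> ?h \<otimes> \<phi> Q)"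
    using h PQR by (simp add: phi_mult)
  also have "\<dots> = \<phi> ?h \<otimes> (\<phi> P \<otimes> \<phi> Q)"
    using h PQR phi_central[of ?h "\<phi> P"] by (simp flip: G.m_assoc)
  finally have 2: "gk G \<phi> (n + 1) gs ?K (j + 1) = \<phi> ?h \<otimes> (\<phi> P \<otimes> \<phi> Q) \<otimes> R"
    using gs by (simp add: gk_eq R_def)
  show ?thesis
    using h PQR by (simp only: 1 2) (simp add: G.m_assoc)
qed

end

section \<open>The simplices of a birack generator and their faces\<close>

text \<open>Both terms of index \<open>i\<close> in the birack boundary at once: the exponent \<open>e = 1\<close> gives the
  biquandle operations by the entry at \<open>i\<close>, and \<open>e = 0\<close> replaces the acting group element by the
  neutral one, which leaves a mere deletion.\<close>

definition face :: "nat \<Rightarrow> nat \<Rightarrow> ('m \<times> 'g) list \<Rightarrow> ('m \<times> 'g) list" where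
  "face e i xs =
    (let n = fst (xs ! i); h = snd (xs ! i) [^] e in
     map (\<lambda>x. (gact M (fst x) h \<oplus>\<^bsub>M\<^esub> (gact M n (\<phi> h) \<ominus>\<^bsub>M\<^esub> gact M n h), inv h \<otimes> snd x \<otimes> h))
       (take i xs) @
     map (\<lambda>x. (gact M (fst x) (\<phi> h), snd x)) (drop (i + 1) xs))"

lemma face_0:
  assumes xs: "set xs \<subseteq> carrier M \<times> carrier G" and i: "i < length xs"
  shows "face 0 i xs = take i xs @ drop (i + 1) xs"
proof -
  have n: "fst (xs ! i) \<in> carrier M"
    using xs i nth_mem by fastforce
  have "map (\<lambda>x. (gact M (fst x) \<one> \<oplus>\<^bsub>M\<^esub> (gact M (fst (xs ! i)) (\<phi> \<one>) \<ominus>\<^bsub>M\<^esub> gact M (fst (xs ! i)) \<one>),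
      inv \<one> \<otimes> snd x \<otimes> \<one>)) (take i xs) = take i xs"
    using xs n by (intro map_idI) (auto dest!: in_set_takeD simp: a_minus_def M.M.r_neg)
  moreover have "map (\<lambda>x. (gact M (fst x) (\<phi> \<one>), snd x)) (drop (i + 1) xs) = drop (i + 1) xs"
    using xs by (intro map_idI) (auto dest!: in_set_dropD)
  ultimately show ?thesis by (simp add: face_def Let_def)
qed

lemma face_1:
  assumes xs: "set xs \<subseteq> carrier M \<times> carrier G" and i: "i < length xs"
  defines "X \<equiv> alexander_biquandle G M \<phi>"
  shows "face 1 i xs = map (\<lambda>x. under_op X x (xs ! i)) (take i xs) @
    map (\<lambda>x. over_op X x (xs ! i)) (drop (i + 1) xs)"
proof -
  obtain n h where nh: "xs ! i = (n, h)" by fastforce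
  moreover have "n \<in> carrier M" "h \<in> carrier G"
    using xs i nth_mem[OF i] by (auto simp: nh)
  ultimately show ?thesis
    by (simp add: face_def Let_def X_def alexander_biquandle_def act_scalar_diff case_prod_unfold)
qed

lemma length_face: "i < length xs \<Longrightarrow> length (face e i xs) = length xs - 1"
  by (simp add: face_def Let_def)

lemma face_nth_below:
  fixes e :: nat
  assumes "i < length xs" "j < i"
  defines "h \<equiv> snd (xs ! i) [^] e"
  shows "face e i xs ! j =
    (gact M (fst (xs ! j)) h \<oplus>\<^bsub>M\<^esub> (gact M (fst (xs ! i)) (\<phi> h) \<ominus>\<^bsub>M\<^esub> gact M (fst (xs ! i)) h),
     inv h \<otimes> snd (xs ! j) \<otimes> h)"
  using assms by (simp add: face_def Let_def nth_append)

lemma face_nth_above: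
  fixes e :: nat
  assumes "i < length xs" "i \<le> j" "j + 1 < length xs"
  defines "h \<equiv> snd (xs ! i) [^] e"
  shows "face e i xs ! j = (gact M (fst (xs ! (j + 1))) (\<phi> h), snd (xs ! (j + 1)))"
  using assms by (simp add: face_def Let_def nth_append)

lemma face_closed:
  assumes xs: "set xs \<subseteq> carrier M \<times> carrier G" and i: "i < length xs"
  shows "set (face e i xs) \<subseteq> carrier M \<times> carrier G"
proof -
  have "xs ! i \<in> carrier M \<times> carrier G"
    using xs i nth_mem by blast
  then have "fst (xs ! i) \<in> carrier M" "snd (xs ! i) \<in> carrier G"
    by (auto simp: mem_Times_iff)
  then show ?thesis
    using xs by (auto simp: face_def Let_def dest!: in_set_takeD in_set_dropD)
qed

text \<open>The module part of \<open>\<gamma>\<close>.\<close>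

definition diffs :: "nat \<Rightarrow> ('m \<times> 'g) list \<Rightarrow> nat \<Rightarrow> 'm" where
  "diffs n xs j = (if j < n then fst (xs ! j) \<ominus>\<^bsub>M\<^esub> fst (xs ! (j + 1)) else fst (xs ! n))"

lemma diffs_closed:
  assumes "set xs \<subseteq> carrier M \<times> carrier G" "n < length xs"
  shows "diffs n xs j \<in> carrier M"
proof -
  have "fst (xs ! j) \<in> carrier M" if "j \<le> n" for j
  proof -
    have "xs ! j \<in> carrier M \<times> carrier G"
      using assms that by (intro subsetD[OF assms(1)] nth_mem) simp
    then show ?thesis by (simp add: mem_Times_iff)
  qed
  then show ?thesis by (auto simp: diffs_def)
qed

text \<open>The translation part \<open>n (\<phi> h - h)\<close> of the lower operation is the same for all entries before
  \<open>i\<close>, so it cancels in their differences. It survives only in the difference across the deleted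
  entry, where it splits \<open>m\<^sub>i\<^sub>-\<^sub>1 h + m\<^sub>i (\<phi> h - h) - m\<^sub>i\<^sub>+\<^sub>1 (\<phi> h)\<close> into
  \<open>(m\<^sub>i\<^sub>-\<^sub>1 - m\<^sub>i) h + (m\<^sub>i - m\<^sub>i\<^sub>+\<^sub>1) (\<phi> h)\<close>; for \<open>i = n + 1\<close>, read \<open>m\<^sub>i\<^sub>+\<^sub>1\<close> as \<open>0\<close>.\<close>

lemma diffs_face:
  fixes e :: nat
  assumes xs: "set xs \<subseteq> carrier M \<times> carrier G" "length xs = n + 2"
    and i: "1 \<le> i" "i \<le> n + 1" and j: "j \<le> n"
  defines "h \<equiv> snd (xs ! i) [^] e" and "d \<equiv> diffs (n + 1) xs"
  shows "diffs n (face e i xs) j =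
    (if j + 1 < i then gact M (d j) h
     else if j + 1 = i then gact M (d j) h \<oplus>\<^bsub>M\<^esub> gact M (d (j + 1)) (\<phi> h)
     else gact M (d (j + 1)) (\<phi> h))"
proof -
  have "xs ! a \<in> carrier M \<times> carrier G" if "a \<le> n + 1" for a
    using xs that nth_mem[of a xs] by auto
  then have m: "fst (xs ! a) \<in> carrier M" and g: "snd (xs ! a) \<in> carrier G" if "a \<le> n + 1" for a
    using that by (auto simp: mem_Times_iff)
  have h: "h \<in> carrier G" using g i by (simp add: h_def)
  note le = face_nth_below[of i xs _ e, folded h_def] and ge = face_nth_above[of i xs _ e, folded h_def]
  consider "j + 1 < i" | "j + 1 = i" "j < n" | "j + 1 = i" "j = n" | "i \<le> j" "j < n" | "i \<le> j" "j = n"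
    using j by linarith
  then show ?thesis
  proof cases
    case 1
    have *: "(p \<oplus>\<^bsub>M\<^esub> c) \<ominus>\<^bsub>M\<^esub> (q \<oplus>\<^bsub>M\<^esub> c) = p \<ominus>\<^bsub>M\<^esub> q"
      if "p \<in> carrier M" "q \<in> carrier M" "c \<in> carrier M" for p q c
      using that by (simp add: diff_eq_iff) (simp add: a_minus_def M.M.a_assoc M.M.r_neg1)
    show ?thesis
      using 1 i xs h m by (simp add: diffs_def d_def le act_diff *)
  next
    case 2
    have *: "(p \<oplus>\<^bsub>M\<^esub> (r \<ominus>\<^bsub>M\<^esub> s)) \<ominus>\<^bsub>M\<^esub> t = (p \<ominus>\<^bsub>M\<^esub> s) \<oplus>\<^bsub>M\<^esub> (r \<ominus>\<^bsub>M\<^esub> t)"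
      if "p \<in> carrier M" "r \<in> carrier M" "s \<in> carrier M" "t \<in> carrier M" for p r s t
      using that by (simp add: a_minus_def M.M.a_ac)
    show ?thesis
      using 2 i xs h m by (auto simp: diffs_def d_def le ge act_diff *)
  next
    case 3
    have *: "p \<oplus>\<^bsub>M\<^esub> (r \<ominus>\<^bsub>M\<^esub> s) = (p \<ominus>\<^bsub>M\<^esub> s) \<oplus>\<^bsub>M\<^esub> r"
      if "p \<in> carrier M" "r \<in> carrier M" "s \<in> carrier M" for p r s
      using that by (simp add: a_minus_def M.M.a_ac)
    show ?thesis
      using 3 i xs h m by (auto simp: diffs_def d_def le act_diff *)
  next
    case 4
    then show ?thesis
      using i xs h m by (simp add: diffs_def d_def ge act_diff)
  next
    case 5
    then show ?thesis
      using i xs h m by (simp add: diffs_def d_def ge)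
  qed
qed

text \<open>The summand of \<open>\<psi> \<gamma>\<close> that belongs to the vertex \<open>k\<close> of the cube.\<close>

definition simplex :: "nat \<Rightarrow> ('m \<times> 'g) list \<Rightarrow> (nat \<Rightarrow> nat) \<Rightarrow> 'm list" where
  "simplex n xs k = map (\<lambda>j. gact M (diffs n xs j) (gk G \<phi> n (map snd xs) k j)) [0..<n + 1]"

lemma length_simplex [simp]: "length (simplex n xs k) = n + 1"
  by (simp add: simplex_def)

lemma nth_simplex:
  "j \<le> n \<Longrightarrow> simplex n xs k ! j = gact M (diffs n xs j) (gk G \<phi> n (map snd xs) k j)"
  by (simp add: simplex_def del: upt_Suc)

lemma set_map_snd: "set xs \<subseteq> carrier M \<times> carrier G \<Longrightarrow> set (map snd xs) \<subseteq> carrier G"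
  by auto

lemma simplex_closed:
  assumes "set xs \<subseteq> carrier M \<times> carrier G" "length xs = n + 1"
  shows "set (simplex n xs k) \<subseteq> carrier M"
  using assms set_map_snd[of xs] by (auto simp: simplex_def gk_closed diffs_closed simp del: upt_Suc)

text \<open>The inner faces of the group complex.\<close>

definition merge :: "nat \<Rightarrow> 'm list \<Rightarrow> 'm list" where
  "merge i ms = take (i - 1) ms @ [ms ! (i - 1) \<oplus>\<^bsub>M\<^esub> ms ! i] @ drop (i + 1) ms"

text \<open>The inner face of index \<open>i\<close> of a simplex over the facet \<open>k\<^sub>i = e\<close> is again such a simplex,
  now for a face of the birack. Entry by entry, \<open>diffs_face\<close> brings in a factor \<open>h\<close> or
  \<open>\<phi> h\<close>, which \<open>gk_face_below\<close> and \<open>gk_face_above\<close> absorb into the group element.\<close>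

lemma simplex_face:
  assumes xs: "set xs \<subseteq> carrier M \<times> carrier G" "length xs = n + 2"
    and i: "1 \<le> i" "i \<le> n + 1"
  shows "simplex n (face e i xs) k = merge i (simplex (n + 1) xs (cube_insert n i e k))"
proof (rule nth_equalityI)
  let ?K = "cube_insert n i e k" and ?gs = "map snd xs" and ?gs' = "map snd (face e i xs)"
  let ?d = "diffs (n + 1) xs" and ?h = "map snd xs ! i [^] e"
  let ?g = "gk G \<phi> (n + 1) ?gs ?K" and ?g' = "gk G \<phi> n ?gs' k"
  show "length (simplex n (face e i xs) k) = length (merge i (simplex (n + 1) xs ?K))"
    using i by (simp add: merge_def)
  have gs: "set ?gs \<subseteq> carrier G" "length ?gs = n + 2" using xs by auto
  have gs': "set ?gs' \<subseteq> carrier G" "length ?gs' = n + 1"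
    using xs i face_closed[of xs i e] length_face[of i xs e] by auto
  have h: "?h \<in> carrier G" using gs i by (simp add: G.nth_in_carrier del: nth_map)
  have h': "snd (xs ! i) [^] e = ?h" using xs i by simp
  have gc: "snd (xs ! j) \<in> carrier G" if "j \<le> n + 1" for j
    using G.nth_in_carrier[OF gs(1), of j] xs that by simp
  have below: "?h \<otimes> ?gs' ! j = ?gs ! j \<otimes> ?h" if "j < i" for j
    using that i xs h gc[of j] length_face[of i xs e]
    by (simp add: face_nth_below G.m_assoc[symmetric] gc)
  have above: "?gs' ! j = ?gs ! (j + 1)" if "i \<le> j" "j \<le> n" for j
    using that i xs length_face[of i xs e] by (simp add: face_nth_above)
  have gb: "?h \<otimes> ?g' j = ?g j" if "j < i" for j
    by (rule gk_face_below[OF gs gs' i below above that])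
  have ga: "\<phi> ?h \<otimes> ?g' j = ?g (j + 1)" if "i \<le> j + 1" "j \<le> n" for j
    by (rule gk_face_above[OF gs gs' i below above that])
  have d: "?d j \<in> carrier M" for j using xs by (intro diffs_closed) auto
  fix j assume "j < length (simplex n (face e i xs) k)"
  then have j: "j \<le> n" by simp
  have g': "?g' j \<in> carrier G" using gs' j by (intro gk_closed) auto
  have dh: "gact M (gact M (?d a) ?h) (?g' j) = gact M (?d a) (?h \<otimes> ?g' j)"
    "gact M (gact M (?d a) (\<phi> ?h)) (?g' j) = gact M (?d a) (\<phi> ?h \<otimes> ?g' j)" for a
    using h g' d by (simp_all only: act_mult phi_closed)
  have dc: "gact M (?d a) ?h \<in> carrier M" "gact M (?d a) (\<phi> ?h) \<in> carrier M" for a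
    using h d by (simp_all only: act_closed phi_closed)
  have lhs: "simplex n (face e i xs) k ! j = gact M (diffs n (face e i xs) j) (?g' j)"
    using j by (rule nth_simplex)
  consider "j + 1 < i" | "j + 1 = i" | "i \<le> j" by linarith
  then show "simplex n (face e i xs) k ! j = merge i (simplex (n + 1) xs ?K) ! j"
  proof cases
    case 1
    have "diffs n (face e i xs) j = gact M (?d j) ?h"
      using 1 by (simp only: diffs_face[OF xs i j] h' if_True)
    then have "simplex n (face e i xs) k ! j = gact M (?d j) (?g j)"
      using 1 by (simp only: lhs dh gb)
    moreover have "j < i - 1" using 1 by simp
    ultimately show ?thesis
      using i j by (simp add: merge_def nth_append nth_simplex)
  next
    case 2
    have "diffs n (face e i xs) j = gact M (?d j) ?h \<oplus>\<^bsub>M\<^esub> gact M (?d (j + 1)) (\<phi> ?h)"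
      using 2 by (simp only: diffs_face[OF xs i j] h' less_irrefl if_True if_False refl)
    then have "simplex n (face e i xs) k ! j =
        gact M (?d j) (?h \<otimes> ?g' j) \<oplus>\<^bsub>M\<^esub> gact M (?d (j + 1)) (\<phi> ?h \<otimes> ?g' j)"
      using g' by (simp only: lhs act_add[OF g' dc] dh)
    also have "\<dots> = gact M (?d j) (?g j) \<oplus>\<^bsub>M\<^esub> gact M (?d (j + 1)) (?g (j + 1))"
      using 2 j gb[of j] ga[of j] by simp
    finally show ?thesis
      using 2 i j by (auto simp: merge_def nth_append nth_simplex)
  next
    case 3
    have "diffs n (face e i xs) j = gact M (?d (j + 1)) (\<phi> ?h)"
      using 3 by (simp add: diffs_face[OF xs i j] h' del: nth_map)
    then have "simplex n (face e i xs) k ! j = gact M (?d (j + 1)) (?g (j + 1))"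
      using 3 j ga[of j] by (simp only: lhs dh)
    then show ?thesis
      using 3 i j by (auto simp: merge_def nth_append nth_simplex)
  qed
qed

text \<open>Both sides are compared with the products over the list without its head, in which \<open>g\<^sub>1\<close>
  sits at index \<open>0\<close> and thus outside all products; by \<open>gk_face_above\<close> they differ from
  these by the central factors \<open>\<phi> g\<^sub>1\<close> and \<open>\<phi> \<one>\<close>.\<close>

lemma tl_simplex:
  assumes xs: "set xs \<subseteq> carrier M \<times> carrier G" "length xs = n + 2"
  shows "tl (simplex (n + 1) xs (cube_insert n 1 1 k)) =
    map (\<lambda>m. gact M m (\<phi> (snd (xs ! 1)))) (tl (simplex (n + 1) xs (cube_insert n 1 0 k)))"
proof (rule nth_equalityI)
  let ?gs = "map snd xs"
  fix j assume "j < length (tl (simplex (n + 1) xs (cube_insert n 1 1 k)))"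
  then have j: "j \<le> n" by simp
  have gs: "set ?gs \<subseteq> carrier G" "length ?gs = n + 2" using xs by auto
  then have gs': "set (tl ?gs) \<subseteq> carrier G" "length (tl ?gs) = n + 1"
    using xs by (cases xs; auto)+
  have g1: "?gs ! 1 \<in> carrier G" using gs by (intro G.nth_in_carrier) auto
  \<comment> \<open>With \<open>i = 1\<close> there is no entry of positive index before the deleted one, so the same
    shortened list serves for both exponents.\<close>
  have "\<phi> (?gs ! 1 [^] e) \<otimes> gk G \<phi> n (tl ?gs) k j =
      gk G \<phi> (n + 1) ?gs (cube_insert n 1 e k) (j + 1)" for e :: nat
    by (rule gk_face_above[OF gs gs']) (use j gs in \<open>auto simp: nth_tl\<close>)
  from this[of 0] this[of 1]
  have "gk G \<phi> (n + 1) ?gs (cube_insert n 1 1 k) (j + 1) =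
      gk G \<phi> (n + 1) ?gs (cube_insert n 1 0 k) (j + 1) \<otimes> \<phi> (snd (xs ! 1))"
    using g1 gs' j xs gk_closed[of "tl ?gs" n j k] phi_central[of "snd (xs ! 1)"] by simp
  then show "tl (simplex (n + 1) xs (cube_insert n 1 1 k)) ! j =
    map (\<lambda>m. gact M m (\<phi> (snd (xs ! 1)))) (tl (simplex (n + 1) xs (cube_insert n 1 0 k))) ! j"
    using j xs g1 gk_closed[OF gs(1), of "n + 1" "j + 1"] diffs_closed[of xs "n + 1" "j + 1"]
    by (simp add: nth_tl nth_simplex act_mult)
qed simp

text \<open>In every entry but the last, the power of \<open>g\<^sub>n\<^sub>+\<^sub>1\<close> is the rightmost factor and lies outside
  \<open>\<phi>\<close>.\<close>

lemma butlast_simplex: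
  assumes xs: "set xs \<subseteq> carrier M \<times> carrier G" "length xs = n + 2"
  shows "butlast (simplex (n + 1) xs (cube_insert n (n + 1) 1 k)) =
    map (\<lambda>m. gact M m (snd (xs ! (n + 1)))) (butlast (simplex (n + 1) xs (cube_insert n (n + 1) 0 k)))"
proof (rule nth_equalityI)
  let ?gs = "map snd xs" and ?K = "\<lambda>e. cube_insert n (n + 1) e k"
  fix j assume "j < length (butlast (simplex (n + 1) xs (?K 1)))"
  then have j: "j \<le> n" by simp
  have gs: "set ?gs \<subseteq> carrier G" "length ?gs = n + 2" using xs by auto
  have g: "snd (xs ! (n + 1)) \<in> carrier G"
    using G.nth_in_carrier[OF gs(1), of "n + 1"] xs by simp
  have "kprod G ?gs (?K e) a b = kprod G ?gs k a b" if "1 \<le> a" "b \<le> n" for e a b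
    using that by (intro G.kprod_cong) (auto simp: cube_insert_def)
  moreover have "kprod G ?gs (?K e) (j + 1) (n + 1) =
      kprod G ?gs (?K e) (j + 1) n \<otimes> ?gs ! (n + 1) [^] e" for e
    using gs j G.kprod_split[of ?gs "n + 1" "j + 1" n "?K e"] G.kprod_single[of ?gs "n + 1" "?K e"]
    by (simp add: cube_insert_def)
  ultimately have "gk G \<phi> (n + 1) ?gs (?K e) j =
      \<phi> (kprod G ?gs k 1 j) \<otimes> (kprod G ?gs k (j + 1) n \<otimes> ?gs ! (n + 1) [^] e)" for e
    using gs j by (simp add: gk_eq)
  from this[of 0] this[of 1]
  have "gk G \<phi> (n + 1) ?gs (?K 1) j = gk G \<phi> (n + 1) ?gs (?K 0) j \<otimes> snd (xs ! (n + 1))"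
    using g gs j xs by (simp add: G.kprod_closed G.m_assoc)
  then show "butlast (simplex (n + 1) xs (?K 1)) ! j =
    map (\<lambda>m. gact M m (snd (xs ! (n + 1)))) (butlast (simplex (n + 1) xs (?K 0))) ! j"
    using j xs g gk_closed[OF gs(1), of "n + 1" j] diffs_closed[of xs "n + 1" j]
    by (simp add: nth_butlast nth_simplex act_mult)
qed simp

section \<open>Coinvariants of the group complex\<close>

lemma frag_cmul_diff_right: "frag_cmul c (a - b) = frag_cmul c a - frag_cmul c b"
  by (metis add_diff_cancel_right' diff_add_cancel frag_cmul_distrib2)

lemma map_act_gens:
  assumes "ms \<in> gp_gens M n" "g \<in> carrier G"
  shows "map (\<lambda>m. gact M m g) ms \<in> gp_gens M n"
  using assms by (auto simp: gp_gens_def split: if_splits)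

lemma subgroup_gp_rel: "subgroup (gp_rel G M n) (gp_chain M n)"
  unfolding gp_rel_def gp_chain_def
proof (rule group.generate_is_subgroup[OF group_free_Abelian_group], safe)
  fix ms g assume "ms \<in> gp_gens M n" "g \<in> carrier G"
  then show "frag_of (map (\<lambda>m. gact M m g) ms) - frag_of ms
      \<in> carrier (free_Abelian_group (gp_gens M n))"
    using keys_diff[of "frag_of (map (\<lambda>m. gact M m g) ms)" "frag_of ms"] map_act_gens[of ms n g]
    by auto
qed

lemma gp_rel_zero: "0 \<in> gp_rel G M n"
  using subgroup.one_closed[OF subgroup_gp_rel[of n]] by (simp add: gp_chain_def)

lemma gp_rel_add: "x \<in> gp_rel G M n \<Longrightarrow> y \<in> gp_rel G M n \<Longrightarrow> x + y \<in> gp_rel G M n"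
  using subgroup.m_closed[OF subgroup_gp_rel[of n], of x y] by (simp add: gp_chain_def)

lemma gp_rel_keys: "x \<in> gp_rel G M n \<Longrightarrow> Poly_Mapping.keys x \<subseteq> gp_gens M n"
  using subgroup.subset[OF subgroup_gp_rel[of n]]
  by (metis carrier_free_Abelian_group_iff gp_chain_def subsetD)

lemma gp_rel_minus: "x \<in> gp_rel G M n \<Longrightarrow> - x \<in> gp_rel G M n"
  using subgroup.m_inv_closed[OF subgroup_gp_rel[of n], of x] gp_rel_keys[of x n]
  by (simp add: gp_chain_def)

lemma gp_rel_sign: "x \<in> gp_rel G M n \<Longrightarrow> frag_cmul ((-1) ^ j) x \<in> gp_rel G M n"
  by (simp add: minus_one_power_iff gp_rel_minus)

lemma gp_rel_sum: "(\<And>i. i \<in> I \<Longrightarrow> x i \<in> gp_rel G M n) \<Longrightarrow> sum x I \<in> gp_rel G M n"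
  by (induction I rule: infinite_finite_induct) (auto simp: gp_rel_zero gp_rel_add)

lemma gp_rel_act:
  assumes "ms \<in> gp_gens M n" "g \<in> carrier G"
  shows "frag_of (map (\<lambda>m. gact M m g) ms) - frag_of ms \<in> gp_rel G M n"
  unfolding gp_rel_def using assms by (intro generate.incl) auto

lemma gp_boundary_gen_merge:
  "gp_boundary_gen M n ms = frag_of (tl ms) +
    (\<Sum>i = 1..n - 1. frag_cmul ((-1) ^ i) (frag_of (merge i ms))) +
    frag_cmul ((-1) ^ n) (frag_of (butlast ms))"
  by (simp add: gp_boundary_gen_def merge_def)

lemma faces_in_gens:
  assumes ms: "ms \<in> gp_gens M (n + 1)" and n: "1 \<le> n"
  shows "tl ms \<in> gp_gens M n" "butlast ms \<in> gp_gens M n"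
    and "1 \<le> i \<Longrightarrow> i \<le> n \<Longrightarrow> merge i ms \<in> gp_gens M n"
proof -
  have len: "length ms = n + 1" and car: "set ms \<subseteq> carrier M"
    using ms by (auto simp: gp_gens_def)
  show "tl ms \<in> gp_gens M n"
    using n len car by (cases ms) (auto simp: gp_gens_def)
  show "butlast ms \<in> gp_gens M n"
    using n len car by (auto simp: gp_gens_def dest: in_set_butlastD)
  assume i: "1 \<le> i" "i \<le> n"
  have "ms ! (i - 1) \<in> carrier M" "ms ! i \<in> carrier M"
    using i len by (auto intro!: subsetD[OF car])
  then show "merge i ms \<in> gp_gens M n"
    using n len car i by (auto simp: gp_gens_def merge_def dest: in_set_takeD in_set_dropD)
qed

lemma map_act_merge:
  assumes ms: "ms \<in> gp_gens M (n + 1)" and g: "g \<in> carrier G" and i: "1 \<le> i" "i \<le> n"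
  shows "merge i (map (\<lambda>m. gact M m g) ms) = map (\<lambda>m. gact M m g) (merge i ms)"
proof -
  have len: "length ms = n + 1" and car: "set ms \<subseteq> carrier M"
    using ms by (auto simp: gp_gens_def)
  have "ms ! (i - 1) \<in> carrier M" "ms ! i \<in> carrier M"
    using i len by (auto intro!: subsetD[OF car])
  then show ?thesis
    using i len g by (simp add: merge_def take_map drop_map act_add)
qed

text \<open>Every face commutes with the diagonal action, so the boundary of a relation is a signed sum of
  relations.\<close>

lemma gp_boundary_gen_act:
  assumes ms: "ms \<in> gp_gens M (n + 1)" and n: "1 \<le> n" and g: "g \<in> carrier G"
  shows "gp_boundary_gen M (n + 1) (map (\<lambda>m. gact M m g) ms) - gp_boundary_gen M (n + 1) ms
    \<in> gp_rel G M n"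
proof -
  let ?a = "map (\<lambda>m. gact M m g)"
  let ?D = "\<lambda>l. frag_of (?a l) - frag_of l"
  have "gp_boundary_gen M (n + 1) (?a ms) - gp_boundary_gen M (n + 1) ms =
      ?D (tl ms) + (\<Sum>i = 1..n. frag_cmul ((-1) ^ i) (frag_of (merge i (?a ms)) - frag_of (merge i ms)))
        + frag_cmul ((-1) ^ (n + 1)) (?D (butlast ms))"
    unfolding gp_boundary_gen_merge
    by (simp add: map_tl map_butlast frag_cmul_diff_right sum_subtractf)
  also have "(\<Sum>i = 1..n. frag_cmul ((-1) ^ i) (frag_of (merge i (?a ms)) - frag_of (merge i ms))) =
      (\<Sum>i = 1..n. frag_cmul ((-1) ^ i) (?D (merge i ms)))"
    using ms g by (intro sum.cong refl) (simp add: map_act_merge[of ms n])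
  also have "?D (tl ms) + \<dots> + frag_cmul ((-1) ^ (n + 1)) (?D (butlast ms)) \<in> gp_rel G M n"
    using g faces_in_gens[OF ms n]
    by (intro gp_rel_add gp_rel_sum gp_rel_sign gp_rel_act) auto
  finally show ?thesis .
qed

lemma gp_boundary_rel:
  assumes c: "c \<in> gp_rel G M (n + 1)" and n: "1 \<le> n"
  shows "gp_boundary M (n + 1) c \<in> gp_rel G M n"
  using c unfolding gp_rel_def[of G M "n + 1"]
proof (induction c rule: generate.induct)
  case one
  then show ?case by (simp add: gp_boundary_def gp_chain_def gp_rel_zero)
next
  case (incl h)
  then show ?case
    using n by (auto simp: gp_boundary_def frag_extend_diff gp_boundary_gen_act[simplified])
next
  case (inv h)
  then have "h \<in> gp_rel G M (n + 1)" by (simp add: gp_rel_def generate.incl)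
  then have "inv\<^bsub>gp_chain M (n + 1)\<^esub> h = - h"
    using gp_rel_keys by (simp add: gp_chain_def)
  moreover have "gp_boundary M (n + 1) h \<in> gp_rel G M n"
    using inv n by (auto simp: gp_boundary_def frag_extend_diff gp_boundary_gen_act[simplified])
  ultimately show ?case
    using n by (simp add: gp_boundary_def frag_extend_minus gp_rel_minus)
next
  case (eng h1 h2)
  then show ?case
    using n by (simp add: gp_boundary_def gp_chain_def frag_extend_add gp_rel_add)
qed

lemma normal_gp_rel: "gp_rel G M n \<lhd> gp_chain M n"
  unfolding gp_chain_def
  by (rule comm_group.subgroup_imp_normal[OF abelian_free_Abelian_group
        subgroup_gp_rel[unfolded gp_chain_def]])

lemma gp_proj_hom: "gp_proj G M n \<in> hom (gp_chain M n) (gp_coinv G M n)"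
  using normal.r_coset_hom_Mod[OF normal_gp_rel, of n]
  unfolding gp_coinv_def gp_proj_def[abs_def] .

lemma gp_proj_rel: "c \<in> gp_rel G M n \<Longrightarrow> gp_proj G M n c = \<one>\<^bsub>gp_coinv G M n\<^esub>"
  using subgroup.rcos_const[OF subgroup_gp_rel, of n c]
  by (simp add: gp_proj_def gp_coinv_def gp_chain_def FactGroup_def)

lemma gp_proj_add_rel:
  assumes "r \<in> gp_rel G M n" "Poly_Mapping.keys c \<subseteq> gp_gens M n"
  shows "gp_proj G M n (r + c) = gp_proj G M n c"
proof -
  have "r + c \<in> gp_rel G M n #>\<^bsub>gp_chain M n\<^esub> c"
    using assms by (auto simp: r_coset_def gp_chain_def)
  then show ?thesis
    unfolding gp_proj_def using assms subgroup_gp_rel[of n]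
    by (intro group.repr_independence[symmetric]) (auto simp: gp_chain_def)
qed

lemma keys_gp_boundary:
  assumes c: "Poly_Mapping.keys c \<subseteq> gp_gens M (n + 1)" and n: "1 \<le> n"
  shows "Poly_Mapping.keys (gp_boundary M (n + 1) c) \<subseteq> gp_gens M n"
proof -
  have "gp_boundary_gen M (n + 1) ms \<in> carrier (free_Abelian_group (gp_gens M n))"
    if ms: "ms \<in> gp_gens M (n + 1)" for ms
  proof -
    interpret F: group "free_Abelian_group (gp_gens M n)" by simp
    have add: "x + y \<in> carrier (free_Abelian_group (gp_gens M n))"
      if "x \<in> carrier (free_Abelian_group (gp_gens M n))" "y \<in> carrier (free_Abelian_group (gp_gens M n))"
      for x y using F.m_closed[OF that] by (simp del: carrier_free_Abelian_group_iff)
    show ?thesis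
      unfolding gp_boundary_gen_merge using faces_in_gens[OF ms n]
      by (intro add sum_closed_free_Abelian_group) auto
  qed
  then show ?thesis
    using n c unfolding gp_boundary_def by (auto intro!: keys_frag_extend_subset)
qed

text \<open>All members of the coset of \<open>c\<close> have boundaries in one and the same coset, so the union that
  defines the induced boundary is that coset.\<close>

lemma gp_coinv_boundary_proj:
  assumes c: "Poly_Mapping.keys c \<subseteq> gp_gens M (n + 1)" and n: "1 \<le> n"
  shows "gp_coinv_boundary G M (n + 1) (gp_proj G M (n + 1) c) = gp_proj G M n (gp_boundary M (n + 1) c)"
proof -
  have "gp_proj G M n (gp_boundary M (n + 1) (r + c)) = gp_proj G M n (gp_boundary M (n + 1) c)"
    if "r \<in> gp_rel G M (n + 1)" for r
    using gp_proj_add_rel[OF gp_boundary_rel[OF that n] keys_gp_boundary[OF c n]] n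
    by (simp add: gp_boundary_def frag_extend_add)
  moreover have "gp_proj G M (n + 1) c = (\<lambda>r. r + c) ` gp_rel G M (n + 1)"
    by (auto simp: gp_proj_def r_coset_def gp_chain_def)
  ultimately show ?thesis
    using gp_rel_zero[of "n + 1"] by (auto simp: gp_coinv_boundary_def)
qed

section \<open>Compatibility with the two boundary maps\<close>

text \<open>The value of \<open>\<psi> \<gamma>\<close> at a generator, before passing to coinvariants.\<close>

definition prism :: "nat \<Rightarrow> ('m \<times> 'g) list \<Rightarrow> ('m list \<Rightarrow>\<^sub>0 int)" where
  "prism n xs = (\<Sum>k \<in> {1..n} \<rightarrow>\<^sub>E {0, 1}.
    frag_cmul ((-1) ^ (\<Sum>i = 1..n. k i)) (frag_of (simplex n xs k)))"

lemma psi_gamma: "psi G M \<phi> n (gamma M n c) = gp_proj G M (n + 1) (frag_extend (prism n) c)"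
proof -
  let ?c = "\<lambda>xs. (map snd xs,
     map (\<lambda>i. fst (xs ! i) \<ominus>\<^bsub>M\<^esub> fst (xs ! (i + 1))) [0..<n] @ [fst (xs ! n)])"
  have "psi_gen G M \<phi> n (?c xs) = prism n xs" for xs
  proof -
    have "(map (\<lambda>i. fst (xs ! i) \<ominus>\<^bsub>M\<^esub> fst (xs ! (i + 1))) [0..<n] @ [fst (xs ! n)]) ! j = diffs n xs j"
      if "j < n + 1" for j
      using that by (auto simp: nth_append diffs_def)
    then show ?thesis
      unfolding psi_gen_def prism_def simplex_def
      by (auto intro!: sum.cong arg_cong[where f = "\<lambda>x. frag_cmul _ (frag_of x)"] simp del: upt_Suc)
  qed
  then have "psi_gen G M \<phi> n \<circ> ?c = prism n"
    by (auto simp: fun_eq_iff)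
  then show ?thesis
    using frag_extend_compose[of "psi_gen G M \<phi> n" ?c c] by (simp add: psi_def gamma_def o_def)
qed

lemma prism_keys:
  assumes "set xs \<subseteq> carrier M \<times> carrier G" "length xs = n + 1"
  shows "Poly_Mapping.keys (prism n xs) \<subseteq> gp_gens M (n + 1)"
proof -
  have "simplex n xs k \<in> gp_gens M (n + 1)" for k
    using simplex_closed[OF assms] by (simp add: gp_gens_def)
  then have "prism n xs \<in> carrier (free_Abelian_group (gp_gens M (n + 1)))"
    unfolding prism_def by (intro sum_closed_free_Abelian_group) auto
  then show ?thesis by simp
qed

lemma sum_cube_signed:
  assumes i: "1 \<le> i" "i \<le> n + 1"
  shows "(\<Sum>k \<in> {1..n + 1} \<rightarrow>\<^sub>E {0, 1}. frag_cmul ((-1) ^ (\<Sum>j = 1..n + 1. k j)) (F k)) =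
    (\<Sum>k \<in> {1..n} \<rightarrow>\<^sub>E {0, 1}. frag_cmul ((-1) ^ (\<Sum>j = 1..n. k j))
      (F (cube_insert n i 0 k) - F (cube_insert n i 1 k)))"
  unfolding sum_cube_split[OF i] sum_cube_insert[OF i]
  by (simp add: frag_cmul_diff_right minus_frag_cmul[symmetric] del: minus_frag_cmul)

text \<open>The inner faces reproduce the birack boundary with opposite sign, because the
  group boundary counts them with \<open>(-1)\<^sup>i\<close> and the birack boundary with \<open>(-1)\<^sup>i\<^sup>-\<^sup>1\<close>.
  Only the first and the last faces remain, and for these the two facets \<open>k\<^sub>1 = 0, 1\<close>, respectively \<open>k\<^sub>n\<^sub>+\<^sub>1 = 0, 1\<close>, cancel modulo the relations.\<close>

lemma prism_boundary:
  assumes xs: "set xs \<subseteq> carrier M \<times> carrier G" "length xs = n + 2"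
  shows "gp_boundary M (n + 2) (prism (n + 1) xs) +
    frag_extend (prism n) (br_boundary_gen (alexander_biquandle G M \<phi>) (n + 1) xs)
      \<in> gp_rel G M (n + 1)"
proof -
  let ?C = "\<lambda>n :: nat. {1..n} \<rightarrow>\<^sub>E {0, 1 :: nat}" and ?s = "\<lambda>n (k :: nat \<Rightarrow> nat). (-1) ^ (\<Sum>j = 1..n. k j) :: int"
  let ?S = "simplex (n + 1) xs"
  let ?T = "\<Sum>k \<in> ?C (n + 1). frag_cmul (?s (n + 1) k) (frag_of (tl (?S k)))"
  let ?B = "\<Sum>k \<in> ?C (n + 1). frag_cmul (?s (n + 1) k) (frag_of (butlast (?S k)))"
  let ?D = "\<lambda>i. prism n (face 0 i xs) - prism n (face 1 i xs)"
  have fin: "finite (?C m)" for m by (intro finite_PiE) auto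
  have inner: "(\<Sum>k \<in> ?C (n + 1). frag_cmul (?s (n + 1) k) (frag_of (merge i (?S k)))) = ?D i"
    if "i \<in> {1..n + 1}" for i
  proof -
    have i: "1 \<le> i" "i \<le> n + 1" using that by auto
    show ?thesis
      unfolding sum_cube_signed[OF i] prism_def
      by (simp add: simplex_face[OF xs i] frag_cmul_diff_right sum_subtractf)
  qed
  have "gp_boundary M (n + 2) (prism (n + 1) xs) =
      (\<Sum>k \<in> ?C (n + 1). frag_cmul (?s (n + 1) k) (gp_boundary_gen M (n + 2) (?S k)))"
    using fin by (simp add: gp_boundary_def prism_def frag_extend_sum o_def frag_extend_cmul)
  also have "\<dots> = ?T + (\<Sum>k \<in> ?C (n + 1). \<Sum>i = 1..n + 1.
        frag_cmul ((-1) ^ i) (frag_cmul (?s (n + 1) k) (frag_of (merge i (?S k)))))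
      + frag_cmul ((-1) ^ (n + 2)) ?B"
    unfolding gp_boundary_gen_merge
    by (simp only: frag_cmul_distrib2 sum.distrib frag_cmul_sum frag_cmul_cmul mult.commute o_def)
       simp
  also have "(\<Sum>k \<in> ?C (n + 1). \<Sum>i = 1..n + 1.
        frag_cmul ((-1) ^ i) (frag_cmul (?s (n + 1) k) (frag_of (merge i (?S k))))) =
      (\<Sum>i = 1..n + 1. frag_cmul ((-1) ^ i) (?D i))"
    by (subst sum.swap) (intro sum.cong refl, subst inner[symmetric], auto simp: frag_cmul_sum)
  finally have gp: "gp_boundary M (n + 2) (prism (n + 1) xs) =
      ?T + (\<Sum>i = 1..n + 1. frag_cmul ((-1) ^ i) (?D i)) + frag_cmul ((-1) ^ (n + 2)) ?B" .
  have "br_boundary_gen (alexander_biquandle G M \<phi>) (n + 1) xs =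
      (\<Sum>i = 1..n + 1. frag_cmul ((-1) ^ (i - 1)) (frag_of (face 0 i xs) - frag_of (face 1 i xs)))"
    unfolding br_boundary_gen_def using xs by (intro sum.cong refl) (simp add: face_0 face_1[simplified])
  then have "frag_extend (prism n) (br_boundary_gen (alexander_biquandle G M \<phi>) (n + 1) xs) =
      (\<Sum>i = 1..n + 1. frag_cmul ((-1) ^ (i - 1)) (?D i))"
    by (simp only: frag_extend_sum finite_atLeastAtMost o_def frag_extend_cmul frag_extend_diff
        frag_extend_of)
  also have "\<dots> = (\<Sum>i = 1..n + 1. - frag_cmul ((-1) ^ i) (?D i))"
  proof (intro sum.cong refl)
    fix i assume "i \<in> {1..n + 1}"
    then obtain j where "i = j + 1" by (metis atLeastAtMost_iff le_add_diff_inverse2)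
    then show "frag_cmul ((-1) ^ (i - 1)) (?D i) = - frag_cmul ((-1) ^ i) (?D i)"
      by (simp add: minus_one_power_iff)
  qed
  finally have br: "frag_extend (prism n) (br_boundary_gen (alexander_biquandle G M \<phi>) (n + 1) xs) =
      - (\<Sum>i = 1..n + 1. frag_cmul ((-1) ^ i) (?D i))"
    by (simp only: sum_negf)
  have S: "?S k \<in> gp_gens M (n + 1 + 1)" for k
    using simplex_closed[of xs "n + 1" k] xs by (simp add: gp_gens_def)
  have g: "snd (xs ! j) \<in> carrier G" if "j \<le> n + 1" for j
    using G.nth_in_carrier[OF set_map_snd[OF xs(1)], of j] xs that by simp
  have rel: "frag_cmul (?s n k) (frag_of ms - frag_of (map (\<lambda>m. gact M m h) ms)) \<in> gp_rel G M (n + 1)"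
    if "ms \<in> gp_gens M (n + 1)" "h \<in> carrier G" for k ms h
    using gp_rel_minus[OF gp_rel_act[OF that]] by (intro gp_rel_sign) simp
  have "?T \<in> gp_rel G M (n + 1)"
    unfolding sum_cube_signed[OF order.refl le_add2] tl_simplex[OF xs]
    using faces_in_gens[OF S] g by (intro gp_rel_sum rel) auto
  moreover have "?B \<in> gp_rel G M (n + 1)"
    unfolding sum_cube_signed[OF le_add2 order.refl] butlast_simplex[OF xs]
    using faces_in_gens[OF S] g by (intro gp_rel_sum rel) auto
  ultimately have "?T + frag_cmul ((-1) ^ (n + 2)) ?B \<in> gp_rel G M (n + 1)"
    by (intro gp_rel_add gp_rel_sign)
  moreover have "t + s + b + - s = t + b" for t s b :: "'m list \<Rightarrow>\<^sub>0 int"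
    by simp
  ultimately show ?thesis
    by (simp only: gp br)
qed

lemma prism_boundary_chain:
  assumes n: "1 \<le> n" and c: "Poly_Mapping.keys c \<subseteq> br_gens (alexander_biquandle G M \<phi>) (n + 1)"
  shows "gp_boundary M (n + 2) (frag_extend (prism (n + 1)) c) +
    frag_extend (prism n) (br_boundary (alexander_biquandle G M \<phi>) (n + 1) c)
      \<in> gp_rel G M (n + 1)"
  using c
proof (induction c rule: frag_induction)
  case zero
  then show ?case by (simp add: gp_boundary_def br_boundary_def gp_rel_zero)
next
  case (one xs)
  then show ?case
    using n prism_boundary[of xs n]
    by (simp add: br_gens_def br_boundary_def alexander_biquandle_def)
next
  case (diff a b)
  then show ?case
    using n gp_rel_add[OF diff(1) gp_rel_minus[OF diff(2)]]
    by (simp add: gp_boundary_def br_boundary_def frag_extend_diff algebra_simps)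
qed

lemma frag_extend_prism_hom:
  assumes "1 \<le> n"
  shows "frag_extend (prism n) \<in> hom (br_chain (alexander_biquandle G M \<phi>) n) (gp_chain M (n + 1))"
proof (rule homI)
  fix c assume "c \<in> carrier (br_chain (alexander_biquandle G M \<phi>) n)"
  then have "Poly_Mapping.keys c \<subseteq> br_gens (alexander_biquandle G M \<phi>) n"
    by (simp add: br_chain_def)
  then have "Poly_Mapping.keys (frag_extend (prism n) c) \<subseteq> gp_gens M (n + 1)"
    using assms
    by (intro keys_frag_extend_subset prism_keys) (auto simp: br_gens_def alexander_biquandle_def)
  then show "frag_extend (prism n) c \<in> carrier (gp_chain M (n + 1))"
    by (simp add: gp_chain_def)
qed (simp add: br_chain_def gp_chain_def frag_extend_add)

text \<open>The composite \<open>h\<close> of \<open>f\<close> with the projection to the coinvariants kills the relations, and it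
  kills group boundaries by the cocycle condition. By \<open>prism_boundary_chain\<close> it then kills the
  images of birack boundaries.\<close>

lemma pullback_cocycle:
  assumes A: "group A" and n: "1 \<le> n" and f: "group_cocycle G M A (n + 1) f"
  shows "birack_cocycle (alexander_biquandle G M \<phi>) A n (f \<circ> psi G M \<phi> n \<circ> gamma M n)"
  unfolding birack_cocycle_def
proof (intro conjI ballI)
  let ?X = "alexander_biquandle G M \<phi>"
  define h where "h = f \<circ> gp_proj G M (n + 1)"
  have fhom: "f \<in> hom (gp_coinv G M (n + 1)) A"
    and f0: "\<And>K. K \<in> carrier (gp_coinv G M (n + 1 + 1)) \<Longrightarrow>
      f (gp_coinv_boundary G M (n + 1 + 1) K) = \<one>\<^bsub>A\<^esub>"
    using f by (auto simp: group_cocycle_def)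
  have h: "h \<in> hom (gp_chain M (n + 1)) A"
    unfolding h_def by (rule hom_compose[OF gp_proj_hom fhom])
  have eq: "f \<circ> psi G M \<phi> n \<circ> gamma M n = h \<circ> frag_extend (prism n)"
    by (simp add: fun_eq_iff h_def psi_gamma)
  show "f \<circ> psi G M \<phi> n \<circ> gamma M n \<in> hom (br_chain ?X n) A"
    unfolding eq by (rule hom_compose[OF frag_extend_prism_hom[OF n] h])
  have h_rel: "h r = \<one>\<^bsub>A\<^esub>" if "r \<in> gp_rel G M (n + 1)" for r
  proof -
    have "group (gp_coinv G M (n + 1))"
      unfolding gp_coinv_def by (rule normal.factorgroup_is_group[OF normal_gp_rel])
    then show ?thesis
      using hom_one[OF fhom _ A] that by (simp add: h_def gp_proj_rel)
  qed
  fix c assume "c \<in> carrier (br_chain ?X (n + 1))"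
  then have c: "Poly_Mapping.keys c \<subseteq> br_gens ?X (n + 1)"
    and b: "frag_extend (prism (n + 1)) c \<in> carrier (gp_chain M (n + 1 + 1))"
    using hom_in_carrier[OF frag_extend_prism_hom[of "n + 1"]] by (auto simp: br_chain_def)
  let ?u = "gp_boundary M (n + 2) (frag_extend (prism (n + 1)) c)"
  let ?v = "frag_extend (prism n) (br_boundary ?X (n + 1) c)"
  have bk: "Poly_Mapping.keys (frag_extend (prism (n + 1)) c) \<subseteq> gp_gens M (n + 1 + 1)"
    using b by (simp add: gp_chain_def)
  have uv: "?u + ?v \<in> gp_rel G M (n + 1)"
    by (rule prism_boundary_chain[OF n c])
  have u: "?u \<in> carrier (gp_chain M (n + 1))"
    using keys_gp_boundary[OF bk] by (simp add: gp_chain_def)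
  \<comment> \<open>The identity makes \<open>?v\<close> a chain, as the difference of a relation and a group boundary.\<close>
  have "(?u + ?v) - ?u \<in> carrier (gp_chain M (n + 1))"
    using u gp_rel_keys[OF uv] keys_diff[of "?u + ?v" ?u] by (auto simp: gp_chain_def)
  then have v: "?v \<in> carrier (gp_chain M (n + 1))" by simp
  have "h ?u = f (gp_coinv_boundary G M (n + 1 + 1) (gp_proj G M (n + 1 + 1) (frag_extend (prism (n + 1)) c)))"
    using gp_coinv_boundary_proj[OF bk] by (simp add: h_def)
  also have "\<dots> = \<one>\<^bsub>A\<^esub>"
    by (rule f0[OF hom_in_carrier[OF gp_proj_hom b]])
  finally have "h ?u = \<one>\<^bsub>A\<^esub>" .
  moreover have "h (?u + ?v) = h ?u \<otimes>\<^bsub>A\<^esub> h ?v"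
    using hom_mult[OF h u v] by (simp add: gp_chain_def)
  ultimately have "h ?v = \<one>\<^bsub>A\<^esub>"
    using h_rel[OF uv] hom_in_carrier[OF h v] A by (simp add: group.is_monoid)
  then show "(f \<circ> psi G M \<phi> n \<circ> gamma M n) (br_boundary ?X (n + 1) c) = \<one>\<^bsub>A\<^esub>"
    by (simp add: eq)
qed

end

theorem theorem4p4:
  fixes G :: "('g, 'b) monoid_scheme"
    and M :: "('g \<Rightarrow>\<^sub>0 int, 'm, 'c) module_scheme"
    and A :: "('a, 'd) monoid_scheme"
    and \<phi> :: "'g \<Rightarrow> 'g"
    and f :: "('m list \<Rightarrow>\<^sub>0 int) set \<Rightarrow> 'a"
    and n :: nat
  assumes "group G"
    and "right_module (group_ring G) M"
    and "\<phi> \<in> hom G (G\<lparr>carrier := group_center G\<rparr>)"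
    and "comm_group A"
    and "n \<ge> 1"
    and "group_cocycle G M A (n + 1) f"
  shows "birack_cocycle (alexander_biquandle G M \<phi>) A n (f \<circ> psi G M \<phi> n \<circ> gamma M n)"
proof -
  interpret alexander_module G M \<phi>
    using assms(1-3) by (intro alexander_module.intro alexander_module_axioms.intro)
  have "group A"
    using assms(4) by (rule comm_group.axioms)
  then show ?thesis
    using assms(5,6) by (rule pullback_cocycle)
qed

end
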